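(* Let $(X,T,\mathcal{A},\mu)$ be a conservative ergodic measure preserving dynamical system, where $\mu$ is an infinite $\sigma$-finite measure. Let $A\in\mathcal{A}$ with $0<\mu(A)<\infty$ be a uniformly returning set. If the wandering rate $(W_n)=(W_n(A))$ is slowly varying, then $$\Psi_n\ \stackrel{\mathcal{L}(\mu)}{\Longrightarrow}\ \boldsymbol{U},$$ where the random variable $\boldsymbol{U}$ is distributed uniformly on $[0,1]$.
   Context: $\mathcal{P}_\mu$ denotes the set of probability measures $\nu$ on $\mathcal{A}$ with $\nu\ll\mu$; the same symbol is used for the set of the corresponding densities $d\nu/d\mu$. The transfer operator $\hat T:L_1(\mu)\to L_1(\mu)$ is the positive linear operator characterized by $\int_B\hat T(f)\,d\mu=\int_{T^{-1}(B)}f\,d\mu$ for all $f\in L_1(\mu)$, $B\in\mathcal{A}$. A set $A\in\mathcal{A}$ with $0<\mu(A)<\infty$ is uniformly returning for $f\in\mathcal{P}_\mu$ if there is a positive increasing sequence $(b_n)$ diverging to $\infty$ such that $b_n\hat T^n(f)\to1$ $\mu$-a.e. uniformly on $A$ (i.e. in $L_\infty$-norm on $A$). It is called uniformly returning if it is uniformly returning for some $f\in\mathcal{P}_\mu$. Put $A_n:=\bigcup_{k=0}^nT^{-k}A$. The wandering rate of $A$ is $W_n=W_n(A):=\mu(A_n)$, $n\ge0$. The first return time to $A$ is $\varphi(x)=\inf\{n\ge1:T^n(x)\in A\}$, $x\in X$. $Z_n(x):=\max\{k\le n: T^k(x)\in A\}$ (with $k\geq 0$) if $x\in A_n$, and $Z_n(x):=0$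 otherwise. The normalized spent time Kac process is $$\Psi_n:=\frac{\sum_{k=0}^{n-Z_n}\mu(A\cap\{\varphi>k\})}{\mu(A_n)}.$$ A measurable function $R:\mathbb{R}^+\to\mathbb{R}$ with $R>0$ on $(a,\infty)$ for some $a>0$ is slowly varying (at $\infty$) if $\lim_{t\to\infty}R(\lambda t)/R(t)=1$ for all $\lambda>0$. A sequence $(u_n)$ is slowly varying if $u_n=R(n)$, $n\ge1$, for some slowly varying function $R$. Strong distributional convergence $R_n\stackrel{\mathcal{L}(\mu)}{\Longrightarrow}R$ of measurable functions $R_n:X\to\mathbb{R}$ to a random variable $R$ means that for every $\nu\in\mathcal{P}_\mu$ the $R_n$, viewed as random variables on $(X,\mathcal{A},\nu)$, converge in distribution to $R$. *)

theory Defs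
  imports "HOL-Probability.Probability"
begin

definition measure_preserving :: "'a measure \<Rightarrow> ('a \<Rightarrow> 'a) \<Rightarrow> bool" where
  "measure_preserving M T \<longleftrightarrow> T \<in> measurable M M \<and>
     (\<forall>B\<in>sets M. emeasure M (T -` B \<inter> space M) = emeasure M B)"

definition wandering :: "'a measure \<Rightarrow> ('a \<Rightarrow> 'a) \<Rightarrow> 'a set \<Rightarrow> bool" where
  "wandering M T W \<longleftrightarrow> W \<in> sets M \<and>
     disjoint_family (\<lambda>n::nat. (T ^^ n) -` W \<inter> space M)"

definition conservative :: "'a measure \<Rightarrow> ('a \<Rightarrow> 'a) \<Rightarrow> bool" where
  "conservative M T \<longleftrightarrow> (\<forall>W. wandering M T W \<longrightarrow> emeasure M W = 0)"

definition ergodic :: "'a measure \<Rightarrow> ('a \<Rightarrow> 'a) \<Rightarrow> bool" where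
  "ergodic M T \<longleftrightarrow> (\<forall>B\<in>sets M. T -` B \<inter> space M = B \<longrightarrow>
     emeasure M B = 0 \<or> emeasure M (space M - B) = 0)"

definition ac_prob_measures :: "'a measure \<Rightarrow> 'a measure set" where
  "ac_prob_measures M =
     {\<nu>. prob_space \<nu> \<and> sets \<nu> = sets M \<and> absolutely_continuous M \<nu>}"

definition ac_prob_densities :: "'a measure \<Rightarrow> ('a \<Rightarrow> real) set" where
  "ac_prob_densities M =
     {f \<in> borel_measurable M. (AE x in M. 0 \<le> f x) \<and>
        density M (\<lambda>x. ennreal (f x)) \<in> ac_prob_measures M}"

definition is_transfer :: "'a measure \<Rightarrow> ('a \<Rightarrow> 'a) \<Rightarrow> ('a \<Rightarrow> real) \<Rightarrow> ('a \<Rightarrow> real) \<Rightarrow> bool" where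
  "is_transfer M T f g \<longleftrightarrow> integrable M g \<and>
     (\<forall>B\<in>sets M. set_lebesgue_integral M B g
        = set_lebesgue_integral M (T -` B \<inter> space M) f)"

(* Elements of L_1 are represented by functions, so this picks a version of the image;
   is_transfer_exists and is_transfer_unique show that it is well defined up to null sets. *)
definition transfer_op :: "'a measure \<Rightarrow> ('a \<Rightarrow> 'a) \<Rightarrow> ('a \<Rightarrow> real) \<Rightarrow> ('a \<Rightarrow> real)" where
  "transfer_op M T f = (SOME g. is_transfer M T f g)"

lemma is_transfer_unique:
  assumes "is_transfer M T f g" "is_transfer M T f h"
  shows "AE x in M. g x = h x"
  using assms unfolding is_transfer_def
  by (intro density_unique_real) auto

lemma is_transfer_exists:
  assumes "sigma_finite_measure M" "measure_preserving M T" "integrable M f"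
  shows "\<exists>g. is_transfer M T f g"
proof -
  interpret sigma_finite_measure M by fact
  have T[measurable]: "T \<in> measurable M M"
    and pres: "\<And>B. B \<in> sets M \<Longrightarrow> emeasure M (T -` B \<inter> space M) = emeasure M B"
    using assms(2) by (auto simp: measure_preserving_def)
  have pos: "\<exists>g. is_transfer M T f g"
    if f: "integrable M f" "\<And>x. 0 \<le> f x" for f :: "'a \<Rightarrow> real"
  proof -
    have [measurable]: "f \<in> borel_measurable M" using f by auto
    define N where "N = distr (density M (\<lambda>x. ennreal (f x))) M T"
    have sN: "sets N = sets M" by (simp add: N_def)
    have eN: "emeasure N B = ennreal (set_lebesgue_integral M (T -` B \<inter> space M) f)"
      if B[measurable]: "B \<in> sets M" for B
    proof -
      have "emeasure N B = emeasure (density M (\<lambda>x. ennreal (f x))) (T -` B \<inter> space M)"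
        unfolding N_def by (subst emeasure_distr) auto
      also have "\<dots> = (\<integral>\<^sup>+x. ennreal (f x) * indicator (T -` B \<inter> space M) x \<partial>M)"
        by (subst emeasure_density) auto
      also have "\<dots> = (\<integral>\<^sup>+x. ennreal (indicator (T -` B \<inter> space M) x *\<^sub>R f x) \<partial>M)"
        by (intro nn_integral_cong) (auto split: split_indicator)
      also have "\<dots> = ennreal (set_lebesgue_integral M (T -` B \<inter> space M) f)"
        unfolding set_lebesgue_integral_def
        using f integrable_mult_indicator[OF _ f(1), of "T -` B \<inter> space M"]
        by (intro nn_integral_eq_integral) (auto simp: indicator_def)
      finally show ?thesis .
    qed
    have ac: "absolutely_continuous M N"
    proof (unfold absolutely_continuous_def, safe)
      fix B assume B: "B \<in> null_sets M"
      then have Bs[measurable]: "B \<in> sets M" by auto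
      have "T -` B \<inter> space M \<in> null_sets M"
        using B pres[of B] by (auto simp: null_sets_def)
      then have "set_lebesgue_integral M (T -` B \<inter> space M) f = 0"
        unfolding set_lebesgue_integral_def
        by (intro integral_eq_zero_AE) (auto dest!: AE_not_in)
      then show "B \<in> null_sets N" using eN[OF Bs] Bs by (auto simp: null_sets_def sN)
    qed
    have fin: "finite_measure N"
      by standard (use eN[of "space M"] sN in \<open>auto simp: sets_eq_imp_space_eq[OF sN]\<close>)
    interpret N: finite_measure N by fact
    obtain D where D: "D \<in> borel_measurable M" "AE x in M. RN_deriv M N x = ennreal (D x)"
        "AE x in N. 0 < D x" "\<And>x. 0 \<le> D x"
      by (rule real_RN_deriv[OF fin ac sN]) (rule that)
    note [measurable] = D(1)
    have dN: "N = density M (\<lambda>x. ennreal (D x))"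
    proof -
      have "density M (RN_deriv M N) = density M (\<lambda>x. ennreal (D x))"
        by (intro density_cong) (use D(2) in auto)
      then show ?thesis using density_RN_deriv[OF ac sN] by simp
    qed
    have nn: "(\<integral>\<^sup>+x. ennreal (D x) * indicator B x \<partial>M) = emeasure N B"
      if [measurable]: "B \<in> sets M" for B
      using arg_cong[OF dN, of "\<lambda>L. emeasure L B"] by (simp add: emeasure_density)
    have nnt: "(\<integral>\<^sup>+x. ennreal (D x) \<partial>M) = emeasure N (space M)"
      using nn[of "space M"] by (simp cong: nn_integral_cong)
    have iD: "integrable M D"
    proof (rule integrableI_nonneg)
      show "(\<integral>\<^sup>+x. ennreal (D x) \<partial>M) < \<infinity>"
        using nnt eN[of "space M"] by simp
    qed (use D in auto)
    have "set_lebesgue_integral M B D = set_lebesgue_integral M (T -` B \<inter> space M) f"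
      if B[measurable]: "B \<in> sets M" for B
    proof -
      have "ennreal (set_lebesgue_integral M B D)
          = (\<integral>\<^sup>+x. ennreal (indicator B x *\<^sub>R D x) \<partial>M)"
        unfolding set_lebesgue_integral_def
        using D(4) integrable_mult_indicator[OF B iD]
        by (intro nn_integral_eq_integral[symmetric]) (auto simp: indicator_def)
      also have "\<dots> = (\<integral>\<^sup>+x. ennreal (D x) * indicator B x \<partial>M)"
        by (intro nn_integral_cong) (auto split: split_indicator)
      finally have "ennreal (set_lebesgue_integral M B D)
          = ennreal (set_lebesgue_integral M (T -` B \<inter> space M) f)"
        using nn[OF B] eN[OF B] by simp
      moreover have "0 \<le> set_lebesgue_integral M B D"
        "0 \<le> set_lebesgue_integral M (T -` B \<inter> space M) f"
        using D(4) f(2) by (auto simp: set_lebesgue_integral_def intro!: integral_nonneg_AE)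
      ultimately show ?thesis by (simp add: ennreal_inj)
    qed
    with iD show ?thesis unfolding is_transfer_def by blast
  qed
  have f[measurable]: "integrable M f" by fact
  obtain g where g: "is_transfer M T (\<lambda>x. max 0 (f x)) g"
    using pos[of "\<lambda>x. max 0 (f x)"] f by auto
  obtain h where h: "is_transfer M T (\<lambda>x. max 0 (- f x)) h"
    using pos[of "\<lambda>x. max 0 (- f x)"] f by auto
  have si: "set_integrable M B u" if "integrable M u" "B \<in> sets M" for u :: "'a \<Rightarrow> real" and B
    using integrable_mult_indicator[OF that(2,1)] by (simp add: set_integrable_def)
  have "is_transfer M T f (\<lambda>x. g x - h x)"
    unfolding is_transfer_def
  proof safe
    show "integrable M (\<lambda>x. g x - h x)" using g h by (auto simp: is_transfer_def)
    fix B assume B[measurable]: "B \<in> sets M"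
    let ?C = "T -` B \<inter> space M"
    have "set_lebesgue_integral M B (\<lambda>x. g x - h x)
        = set_lebesgue_integral M B g - set_lebesgue_integral M B h"
      using g h B by (intro set_integral_diff si) (auto simp: is_transfer_def)
    also have "\<dots> = set_lebesgue_integral M ?C (\<lambda>x. max 0 (f x))
        - set_lebesgue_integral M ?C (\<lambda>x. max 0 (- f x))"
      using g h B by (auto simp: is_transfer_def)
    also have "\<dots> = set_lebesgue_integral M ?C (\<lambda>x. max 0 (f x) - max 0 (- f x))"
      using f by (intro set_integral_diff(2)[symmetric] si) auto
    also have "(\<lambda>x. max 0 (f x) - max 0 (- f x)) = f" by auto
    finally show "set_lebesgue_integral M B (\<lambda>x. g x - h x) = set_lebesgue_integral M ?C f" .
  qed
  then show ?thesis by blast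
qed

definition uniformly_returning_for ::
    "'a measure \<Rightarrow> ('a \<Rightarrow> 'a) \<Rightarrow> 'a set \<Rightarrow> ('a \<Rightarrow> real) \<Rightarrow> bool" where
  "uniformly_returning_for M T A f \<longleftrightarrow>
     A \<in> sets M \<and> 0 < emeasure M A \<and> emeasure M A < \<infinity> \<and> f \<in> ac_prob_densities M \<and>
     (\<exists>b :: nat \<Rightarrow> real. (\<forall>n. 0 < b n) \<and> incseq b \<and> filterlim b at_top sequentially \<and>
        (\<exists>N\<in>null_sets M.
           uniform_limit (A - N) (\<lambda>n x. b n * (transfer_op M T ^^ n) f x) (\<lambda>_. 1) sequentially))"

definition uniformly_returning :: "'a measure \<Rightarrow> ('a \<Rightarrow> 'a) \<Rightarrow> 'a set \<Rightarrow> bool" where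
  "uniformly_returning M T A \<longleftrightarrow>
     (\<exists>f\<in>ac_prob_densities M. uniformly_returning_for M T A f)"

definition hit_set :: "'a measure \<Rightarrow> ('a \<Rightarrow> 'a) \<Rightarrow> 'a set \<Rightarrow> nat \<Rightarrow> 'a set" where
  "hit_set M T A n = (\<Union>k\<in>{0..n}. (T ^^ k) -` A \<inter> space M)"

definition wandering_rate :: "'a measure \<Rightarrow> ('a \<Rightarrow> 'a) \<Rightarrow> 'a set \<Rightarrow> nat \<Rightarrow> real" where
  "wandering_rate M T A n = measure M (hit_set M T A n)"

(* Takes the value infinity (= Inf {}) at points that never return to A. *)
definition first_return :: "('a \<Rightarrow> 'a) \<Rightarrow> 'a set \<Rightarrow> 'a \<Rightarrow> enat" where
  "first_return T A x = Inf {enat n |n. 1 \<le> n \<and> (T ^^ n) x \<in> A}"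

definition last_visit :: "'a measure \<Rightarrow> ('a \<Rightarrow> 'a) \<Rightarrow> 'a set \<Rightarrow> nat \<Rightarrow> 'a \<Rightarrow> nat" where
  "last_visit M T A n x =
     (if x \<in> hit_set M T A n then Max {k. k \<le> n \<and> (T ^^ k) x \<in> A} else 0)"

definition spent_time_kac :: "'a measure \<Rightarrow> ('a \<Rightarrow> 'a) \<Rightarrow> 'a set \<Rightarrow> nat \<Rightarrow> 'a \<Rightarrow> real" where
  "spent_time_kac M T A n x =
     (\<Sum>k = 0..n - last_visit M T A n x.
        measure M (A \<inter> {y \<in> space M. enat k < first_return T A y}))
     / measure M (hit_set M T A n)"

(* Values of R on the non-positive half-line are irrelevant. *)
definition slowly_varying :: "(real \<Rightarrow> real) \<Rightarrow> bool" where
  "slowly_varying R \<longleftrightarrow>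
     R \<in> borel_measurable (restrict_space borel {0<..}) \<and>
     (\<exists>a>0. \<forall>t>a. 0 < R t) \<and>
     (\<forall>l>0. ((\<lambda>t. R (l * t) / R t) \<longlongrightarrow> 1) at_top)"

definition slowly_varying_seq :: "(nat \<Rightarrow> real) \<Rightarrow> bool" where
  "slowly_varying_seq u \<longleftrightarrow> (\<exists>R. slowly_varying R \<and> (\<forall>n\<ge>1. u n = R (real n)))"

definition strong_distributional_conv ::
    "'a measure \<Rightarrow> (nat \<Rightarrow> 'a \<Rightarrow> real) \<Rightarrow> 'b measure \<Rightarrow> ('b \<Rightarrow> real) \<Rightarrow> bool" where
  "strong_distributional_conv M R P U \<longleftrightarrow>
     (\<forall>n. R n \<in> borel_measurable M) \<and>
     (\<forall>\<nu>\<in>ac_prob_measures M. weak_conv_m (\<lambda>n. distr \<nu> borel (R n)) (distr P borel U))"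

end

theory Submission
  imports Defs
begin

text \<open>Put \<open>q k = \<mu>(A \<inter> {\<phi> > k})\<close>. Decomposing \<open>A\<^sub>n\<close> by the last visit gives \<open>W n = q 0 + \<dots> + q n\<close>, so
  \<open>\<Psi>\<^sub>n = W (n - Z\<^sub>n) / W n\<close>. For the density \<open>f\<close> witnessing uniform return, the probability of
  \<open>Z\<^sub>n = k\<close> on \<open>A\<^sub>n\<close> is the integral of \<open>T^k f\<close> (transfer operator) over \<open>A \<inter> {\<phi> > n - k}\<close>, that is,
  asymptotically \<open>q (n - k) / b k\<close>. These numbers sum to \<open>\<nu>\<^sub>f(A\<^sub>n)\<close>, which tends to 1; since \<open>q\<close> and
  \<open>1 / b\<close> are monotone and \<open>W\<close> is slowly varying, this forces \<open>b n \<sim> W n\<close> without any Tauberian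
  theorem, and then \<open>W (n - Z\<^sub>n) \<le> t * W n\<close> has probability close to \<open>(1 / W n) * t * W n = t\<close>.

  To pass from \<open>f\<close> to all absolutely continuous \<open>\<nu>\<close>, note that \<open>\<Psi>\<^sub>n\<close> composed with \<open>T\<close> differs little
  from \<open>\<Psi>\<^sub>n\<close> unless \<open>T^(n+1) x\<close> lies in \<open>A\<close>, an event of vanishing probability. Hence for continuous
  \<open>g\<close> every weak-star cluster point of \<open>g \<circ> \<Psi>\<^sub>n\<close> is an invariant function, so it is constant.\<close>

subsection \<open>A renewal limit with slowly varying tail sums\<close>

lemma filterlim_half: "filterlim (\<lambda>n::nat. n div 2) at_top sequentially"
  unfolding filterlim_at_top
proof
  fix Z :: nat
  show "\<forall>\<^sub>F n in sequentially. Z \<le> n div 2"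
    using eventually_ge_at_top[of "2 * Z"] by eventually_elim linarith
qed

text \<open>Since \<open>W\<close> is nondecreasing, the sum runs over an initial segment of
  indices. If \<open>l\<close> is the first index with \<open>c < W l\<close>, the terms before
  \<open>l\<close> sum to \<open>W l - q l\<close>, which exceeds \<open>c - q 0\<close>:
  discretization costs at most one term. The upper bound comes from the last index of the
  segment.\<close>

lemma sum_sublevel_bounds:
  fixes q W :: "nat \<Rightarrow> real"
  assumes q: "\<And>n. 0 \<le> q n" "antimono q"
    and W: "\<And>n. W n = (\<Sum>k\<le>n. q k)" and c: "0 \<le> c" "c < W n"
  shows "c - q 0 \<le> (\<Sum>j | j \<le> n \<and> W j \<le> c. q j)" "(\<Sum>j | j \<le> n \<and> W j \<le> c. q j) \<le> c"
proof -
  let ?J = "{j. j \<le> n \<and> W j \<le> c}"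
  define l where "l = (LEAST j. c < W j)"
  have l: "c < W l" "l \<le> n"
    unfolding l_def using c(2) by (rule LeastI, rule Least_le)
  have below: "W j \<le> c" if "j < l" for j
    using not_less_Least[of j "\<lambda>j. c < W j"] that by (simp add: l_def not_less)
  have "W l = q l + (\<Sum>j<l. q j)"
    by (simp add: W lessThan_Suc_atMost[symmetric])
  moreover have "q l \<le> q 0" using q(2) by (simp add: antimono_def)
  moreover have "(\<Sum>j<l. q j) \<le> sum q ?J"
    using below l by (intro sum_mono2) (auto intro: q)
  ultimately show "c - q 0 \<le> sum q ?J" using l by linarith
  show "sum q ?J \<le> c"
  proof (cases "?J = {}")
    case True
    show ?thesis unfolding True using c(1) by simp
  next
    case False
    have fin: "finite ?J" by simp
    have "Max ?J \<in> ?J" using Max_in[OF fin False] .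
    moreover have "sum q ?J \<le> W (Max ?J)"
      unfolding W by (intro sum_mono2) (use fin in \<open>auto intro: q\<close>)
    ultimately show ?thesis by auto
  qed
qed

text \<open>For odd \<open>n\<close>, \<open>W n\<close> differs from
  \<open>W (2 * (n div 2))\<close> by one term of size at most \<open>q 0\<close>, which is
  negligible because \<open>W\<close> diverges. A fixed shift is squeezed between 1 and the halving
  ratio, as \<open>n div 2 \<le> n - K\<close> eventually.\<close>

lemma slowly_varying_sum_shift:
  fixes q W :: "nat \<Rightarrow> real"
  assumes q: "\<And>n. 0 \<le> q n" "antimono q" and q0: "0 < q 0"
    and W: "\<And>n. W n = (\<Sum>k\<le>n. q k)" and Wtop: "filterlim W at_top sequentially"
    and sv: "(\<lambda>n. W (2 * n) / W n) \<longlonglongrightarrow> 1"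
  shows "(\<lambda>n. W n / W (n div 2)) \<longlonglongrightarrow> 1" "(\<lambda>n. W n / W (n - K)) \<longlonglongrightarrow> 1"
proof -
  have Wmono: "W m \<le> W n" if "m \<le> n" for m n
    unfolding W using that q by (intro sum_mono2) auto
  have Wpos: "0 < W n" for n
    using Wmono[of 0 n] q0 by (simp add: W)
  have half: "filterlim (\<lambda>n::nat. n div 2) at_top sequentially"
    by (rule filterlim_half)
  have "(\<lambda>m. W (2 * m) / W m + q 0 / W m) \<longlonglongrightarrow> 1 + 0"
    by (intro tendsto_add sv tendsto_divide_0[OF tendsto_const]
          filterlim_at_top_imp_at_infinity Wtop)
  from filterlim_compose[OF this half]
  have lim2: "(\<lambda>n. W (2 * (n div 2)) / W (n div 2) + q 0 / W (n div 2)) \<longlonglongrightarrow> 1"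
    by simp
  have upper: "W n / W (n div 2) \<le> W (2 * (n div 2)) / W (n div 2) + q 0 / W (n div 2)" for n
  proof -
    have "W n \<le> W (Suc (2 * (n div 2)))" by (rule Wmono) linarith
    also have "\<dots> \<le> W (2 * (n div 2)) + q 0"
      using q(2) by (simp add: W antimono_def)
    finally show ?thesis unfolding add_divide_distrib[symmetric]
      using Wpos[of "n div 2"] by (simp add: divide_right_mono)
  qed
  have lower: "1 \<le> W n / W (n div 2)" for n
    using Wpos[of "n div 2"] Wmono[of "n div 2" n] by simp
  show lim: "(\<lambda>n. W n / W (n div 2)) \<longlonglongrightarrow> 1"
    by (rule tendsto_sandwich[OF _ _ tendsto_const lim2]) (simp_all add: upper lower)
  show "(\<lambda>n. W n / W (n - K)) \<longlonglongrightarrow> 1"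
  proof (rule tendsto_sandwich[OF _ _ tendsto_const lim])
    show "\<forall>\<^sub>F n in sequentially. 1 \<le> W n / W (n - K)"
      using Wpos Wmono by simp
    show "\<forall>\<^sub>F n in sequentially. W n / W (n - K) \<le> W n / W (n div 2)"
      using eventually_ge_at_top[of "2 * K"]
    proof eventually_elim
      case (elim n)
      then have "n div 2 \<le> n - K" by linarith
      then show ?case using Wpos Wmono by (intro divide_left_mono) (auto simp: less_imp_le)
    qed
  qed
qed

text \<open>Here \<open>p n k\<close> plays the probability that the last visit up to time
  \<open>n\<close> happens at time \<open>k\<close>, and \<open>a k\<close> plays
  \<open>1 / b k\<close>. Three facts are combined: times in the first half carry vanishing mass,
  \<open>a n * W n\<close> tends to 1, and the sublevel set only involves times in the second half,
  where \<open>a\<close> is essentially \<open>1 / W n\<close>.\<close>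

lemma renewal_limit:
  fixes a q W :: "nat \<Rightarrow> real" and p :: "nat \<Rightarrow> nat \<Rightarrow> real"
  assumes a: "\<And>n. 0 < a n" "antimono a"
    and q: "\<And>n. 0 \<le> q n" "antimono q" and q0: "0 < q 0"
    and W: "\<And>n. W n = (\<Sum>k\<le>n. q k)" and Wtop: "filterlim W at_top sequentially"
    and sv: "(\<lambda>n. W (2 * n) / W n) \<longlonglongrightarrow> 1"
    and p_nonneg: "\<And>n k. 0 \<le> p n k"
    and p_le: "\<And>n. (\<Sum>k\<le>n. p n k) \<le> 1"
    and p_lim: "(\<lambda>n. \<Sum>k\<le>n. p n k) \<longlonglongrightarrow> 1"
    and p_fix: "\<And>k. (\<lambda>n. p n k) \<longlonglongrightarrow> 0"
    and p_asymp: "\<And>e. 0 < e \<Longrightarrow> \<exists>K. \<forall>n k. K \<le> k \<longrightarrow> k \<le> n \<longrightarrow>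
      (1 - e) * (a k * q (n - k)) \<le> p n k \<and> p n k \<le> (1 + e) * (a k * q (n - k))"
    and t: "0 < t" "t < 1"
  shows "(\<lambda>n. \<Sum>j | j \<le> n \<and> W j \<le> t * W n. p n (n - j)) \<longlonglongrightarrow> t"
proof -
  have Wmono: "W m \<le> W n" if "m \<le> n" for m n
    unfolding W using that q by (intro sum_mono2) auto
  have Wpos: "0 < W n" for n
    using Wmono[of 0 n] q0 by (simp add: W)
  have Wne: "W n \<noteq> 0" for n using Wpos[of n] by simp
  have amono: "a n \<le> a m" if "m \<le> n" for m n using a(2) that by (simp add: antimono_def)
  have qmono: "q n \<le> q m" if "m \<le> n" for m n using q(2) that by (simp add: antimono_def)
  have half: "filterlim (\<lambda>n::nat. n div 2) at_top sequentially"
    by (rule filterlim_half)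
  note Whalf = slowly_varying_sum_shift(1)[OF q q0 W Wtop sv]
  note Wshift = slowly_varying_sum_shift(2)[OF q q0 W Wtop sv]
  have Wrefl: "(\<Sum>k\<in>{K..n}. q (n - k)) = W (n - K)" if "K \<le> n" for K n
    unfolding W using that
    by (intro sum.reindex_bij_witness[of _ "\<lambda>j. n - j" "\<lambda>j. n - j"]) auto

  \<comment> \<open>With \<open>m = n div 2\<close>, every \<open>k \<le> m\<close> satisfies
    \<open>q (n - k) \<le> q m\<close>. The mass from \<open>K\<close> to \<open>m\<close> is
    therefore at most a constant times \<open>q m\<close> times the sum of \<open>a\<close>, where
    that sum is of order \<open>m / W m\<close> and \<open>m * q m\<close> is small compared with
    \<open>W m\<close>. The finitely many times below \<open>K\<close> are handled by
    \<open>p_fix\<close>.\<close>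
  have early: "(\<lambda>n. \<Sum>k\<le>n div 2. p n k) \<longlonglongrightarrow> 0"
  proof -
    obtain K where K: "\<And>n k. K \<le> k \<Longrightarrow> k \<le> n \<Longrightarrow>
        (1 - 1/2) * (a k * q (n - k)) \<le> p n k \<and> p n k \<le> (1 + 1/2) * (a k * q (n - k))"
      using p_asymp[of "1/2"] by auto
    \<comment> \<open>Double counting: the total mass over the times \<open>n \<le> 2 * N\<close> is
      at most \<open>2 * N + 1\<close>, while each \<open>k\<close> between \<open>K\<close> and
      \<open>N\<close> contributes at least half of \<open>a k * W (2 * N - k)\<close>, and
      \<open>2 * N - k \<ge> N\<close>.\<close>
    have asum: "(\<Sum>k\<in>{K..N}. a k) * W N \<le> 2 * (2 * N + 1)" for N
    proof -
      have "(\<Sum>k\<in>{K..N}. a k) * W N = (\<Sum>k\<in>{K..N}. a k * W N)" by (simp add: sum_distrib_right)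
      also have "\<dots> \<le> (\<Sum>k\<in>{K..N}. \<Sum>n\<le>2*N. if k \<le> n then a k * q (n - k) else 0)"
      proof (rule sum_mono)
        fix k assume k: "k \<in> {K..N}"
        have "W (2 * N - k) = (\<Sum>n\<in>{k..2*N}. q (n - k))" unfolding W using k
          by (intro sum.reindex_bij_witness[of _ "\<lambda>j. j - k" "\<lambda>j. j + k"]) auto
        moreover have "W N \<le> W (2 * N - k)" using k by (intro Wmono) auto
        ultimately have "a k * W N \<le> a k * (\<Sum>n\<in>{k..2*N}. q (n - k))"
          using a(1)[of k] by (simp add: mult_left_mono)
        also have "\<dots> = (\<Sum>n\<in>{k..2*N}. if k \<le> n then a k * q (n - k) else 0)"
          by (simp add: sum_distrib_left)
        also have "\<dots> = (\<Sum>n\<le>2*N. if k \<le> n then a k * q (n - k) else 0)"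
          by (intro sum.mono_neutral_left) auto
        finally show "a k * W N \<le> (\<Sum>n\<le>2*N. if k \<le> n then a k * q (n - k) else 0)" .
      qed
      also have "\<dots> = (\<Sum>n\<le>2*N. \<Sum>k\<in>{K..N}. if k \<le> n then a k * q (n - k) else 0)"
        by (rule sum.swap)
      also have "\<dots> \<le> (\<Sum>n\<le>2*N. 2)"
      proof (rule sum_mono)
        fix n
        have "(\<Sum>k\<in>{K..N}. if k \<le> n then a k * q (n - k) else 0)
            \<le> (\<Sum>k\<in>{K..N}. if k \<le> n then 2 * p n k else 0)"
          using K by (intro sum_mono) fastforce
        also have "\<dots> = (\<Sum>k\<in>{K..N} \<inter> {..n}. 2 * p n k)"
          by (simp add: sum.inter_restrict[symmetric] sum.If_cases Int_def)
        also have "\<dots> \<le> (\<Sum>k\<le>n. 2 * p n k)"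
          using p_nonneg by (intro sum_mono2) auto
        also have "\<dots> \<le> 2" using p_le[of n] by (simp add: sum_distrib_left[symmetric])
        finally show "(\<Sum>k\<in>{K..N}. if k \<le> n then a k * q (n - k) else 0) \<le> 2" .
      qed
      also have "\<dots> = 2 * (2 * N + 1)" by simp
      finally show ?thesis by simp
    qed
    \<comment> \<open>By monotonicity \<open>q m\<close> is a lower bound for the last
      \<open>m - m div 2\<close> terms of \<open>W m\<close>, and these are at least half of
      \<open>m\<close> many.\<close>
    have qbd: "q m * real m \<le> 2 * (W m - W (m div 2))" for m
    proof -
      have "real m \<le> 2 * real (m - m div 2)" by linarith
      then have "q m * real m \<le> q m * (2 * real (m - m div 2))"
        using q(1) by (intro mult_left_mono)
      also have "\<dots> = 2 * (\<Sum>k\<in>{m div 2<..m}. q m)" by simp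
      also have "\<dots> \<le> 2 * (\<Sum>k\<in>{m div 2<..m}. q k)"
        by (intro mult_left_mono sum_mono qmono) auto
      also have "(\<Sum>k\<in>{m div 2<..m}. q k) = W m - W (m div 2)"
        unfolding W by (subst sum_diff[symmetric]) (auto intro!: sum.cong)
      finally show ?thesis .
    qed
    \<comment> \<open>The constant is \<open>3/2 * 6 * 2\<close>: the factor \<open>1 + 1/2\<close>
      from \<open>K\<close>, the bound \<open>2 * (2 * m + 1) \<le> 6 * m\<close> in
      \<open>asum\<close>, and the factor 2 of \<open>qbd\<close>. So \<open>u m\<close> is 18 times
      the relative increment of \<open>W\<close> from \<open>m div 2\<close> to
      \<open>m\<close>.\<close>
    define u where "u m = 18 * (1 - inverse (W m / W (m div 2)))" for m
    have "u \<longlonglongrightarrow> 18 * (1 - inverse 1)"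
      unfolding u_def by (intro tendsto_intros Whalf) auto
    from filterlim_compose[OF this half]
    have u0: "(\<lambda>n. u (n div 2)) \<longlonglongrightarrow> 0" by simp
    have "(\<lambda>n. (\<Sum>k<K. p n k) + u (n div 2)) \<longlonglongrightarrow> (\<Sum>k<K. 0) + 0"
      by (intro tendsto_add tendsto_sum p_fix u0)
    then have lim: "(\<lambda>n. (\<Sum>k<K. p n k) + u (n div 2)) \<longlonglongrightarrow> 0" by simp
    show ?thesis
    proof (rule tendsto_sandwich[OF _ _ tendsto_const lim])
      show "\<forall>\<^sub>F n in sequentially. 0 \<le> (\<Sum>k\<le>n div 2. p n k)"
        by (simp add: sum_nonneg p_nonneg)
      show "\<forall>\<^sub>F n in sequentially. (\<Sum>k\<le>n div 2. p n k) \<le> (\<Sum>k<K. p n k) + u (n div 2)"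
        using eventually_ge_at_top[of 2]
      proof eventually_elim
        case (elim n)
        define m where "m = n div 2"
        have m: "1 \<le> m" "m \<le> n" "m \<le> n - m" using elim by (auto simp: m_def)
        have "(\<Sum>k\<le>m. p n k) \<le> (\<Sum>k\<in>{..<K} \<union> {K..m}. p n k)"
          using p_nonneg by (intro sum_mono2) auto
        also have "\<dots> = (\<Sum>k<K. p n k) + (\<Sum>k\<in>{K..m}. p n k)"
          by (intro sum.union_disjoint) auto
        also have "(\<Sum>k\<in>{K..m}. p n k) \<le> (\<Sum>k\<in>{K..m}. 3/2 * (a k * q m))"
        proof (rule sum_mono)
          fix k assume k: "k \<in> {K..m}"
          have "p n k \<le> 3/2 * (a k * q (n - k))" using K[of k n] k m by auto
          also have "\<dots> \<le> 3/2 * (a k * q m)"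
            using k m a(1)[of k] by (intro mult_left_mono qmono) auto
          finally show "p n k \<le> 3/2 * (a k * q m)" .
        qed
        also have "\<dots> = 3/2 * q m * (\<Sum>k\<in>{K..m}. a k)"
          by (simp add: sum_distrib_left mult_ac)
        also have "\<dots> \<le> 3/2 * q m * (6 * real m / W m)"
        proof (rule mult_left_mono)
          have "(\<Sum>k\<in>{K..m}. a k) \<le> 2 * (2 * real m + 1) / W m"
            using asum[of m] Wpos[of m] by (simp add: pos_le_divide_eq)
          also have "\<dots> \<le> 6 * real m / W m"
            using m Wpos[of m] by (intro divide_right_mono) auto
          finally show "(\<Sum>k\<in>{K..m}. a k) \<le> 6 * real m / W m" .
        qed (use q in auto)
        also have "\<dots> = 9 * (q m * real m) / W m" by simp
        also have "\<dots> \<le> 9 * (2 * (W m - W (m div 2))) / W m"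
          using qbd[of m] Wpos[of m] by (intro divide_right_mono) auto
        also have "\<dots> = u m" using Wpos[of m] by (simp add: u_def field_simps)
        finally show ?case by (simp add: m_def)
      qed
    qed
  qed

  \<comment> \<open>Monotonicity of \<open>a\<close> replaces a Tauberian argument. Above: all times
    from \<open>K\<close> to \<open>n\<close> have \<open>a k \<ge> a n\<close>, so
    \<open>(1 - e) * a n * W (n - K)\<close> is at most the total mass 1. Below: at time
    \<open>2 * m\<close> the times after \<open>m\<close> carry almost all the mass and have
    \<open>a k \<le> a m\<close>.\<close>
  have aW: "(\<lambda>n. a n * W n) \<longlonglongrightarrow> 1"
  proof (rule order_tendstoI)
    fix u :: real assume u: "1 < u"
    define e where "e = (1 - 1 / u) / 2"
    have e: "0 < e" "e < 1" "1 / (1 - e) < u"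
      using u by (auto simp: e_def field_simps)
    obtain K where K: "\<And>n k. K \<le> k \<Longrightarrow> k \<le> n \<Longrightarrow>
        (1 - e) * (a k * q (n - k)) \<le> p n k" using p_asymp[OF e(1)] by blast
    have "(\<lambda>n. 1 / (1 - e) * (W n / W (n - K))) \<longlonglongrightarrow> 1 / (1 - e) * 1"
      by (intro tendsto_mult tendsto_const Wshift)
    then have "\<forall>\<^sub>F n in sequentially. 1 / (1 - e) * (W n / W (n - K)) < u"
      using e(3) by (intro order_tendstoD) auto
    then show "\<forall>\<^sub>F n in sequentially. a n * W n < u"
      using eventually_ge_at_top[of K]
    proof eventually_elim
      case (elim n)
      have "(1 - e) * (a n * W (n - K)) = (\<Sum>k\<in>{K..n}. (1 - e) * (a n * q (n - k)))"
        unfolding Wrefl[OF elim(2), symmetric] by (simp add: sum_distrib_left)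
      also have "\<dots> \<le> (\<Sum>k\<in>{K..n}. p n k)"
      proof (rule sum_mono)
        fix k assume k: "k \<in> {K..n}"
        have "(1 - e) * (a n * q (n - k)) \<le> (1 - e) * (a k * q (n - k))"
          using k e q by (intro mult_left_mono mult_right_mono amono) auto
        then show "(1 - e) * (a n * q (n - k)) \<le> p n k" using K[of k n] k by force
      qed
      also have "\<dots> \<le> (\<Sum>k\<le>n. p n k)"
        using p_nonneg by (intro sum_mono2) auto
      also have "\<dots> \<le> 1" by (rule p_le)
      finally have "a n \<le> 1 / (1 - e) / W (n - K)"
        using e Wpos[of "n - K"] by (simp add: field_simps)
      then have "a n * W n \<le> 1 / (1 - e) / W (n - K) * W n"
        using Wpos[of n] by (intro mult_right_mono) auto
      then show ?case using elim by simp
    qed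
  next
    fix l :: real assume l: "l < 1"
    define e where "e = (1 - max l (1/2)) / 2"
    have e: "0 < e" "l < 1 / (1 + e)"
    proof -
      show "0 < e" using l by (auto simp: e_def)
      define l' where "l' = max l (1/2)"
      have l': "1/2 \<le> l'" "l' < 1" "l \<le> l'" using l by (auto simp: l'_def)
      \<comment> \<open>As \<open>1 + e = (3 - l') / 2\<close>, the desired
        \<open>l' < 1 / (1 + e)\<close> amounts to \<open>l' * (3 - l') < 2\<close>, which is this
        product being positive.\<close>
      have "(1 - l') * (2 - l') > 0" using l' by simp
      then have "l' * (3 - l') < 2" by (simp add: algebra_simps)
      then have "l' < 1 / (1 + e)" using l' by (simp add: e_def l'_def[symmetric] field_simps)
      then show "l < 1 / (1 + e)" using l' by simp
    qed
    obtain K where K: "\<And>n k. K \<le> k \<Longrightarrow> k \<le> n \<Longrightarrow>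
        p n k \<le> (1 + e) * (a k * q (n - k))" using p_asymp[OF e(1)] by blast
    \<comment> \<open>The mass of the second half, which tends to 1 by \<open>early\<close>. It is
      used only at even times \<open>2 * m\<close>, so that the second half starts right after
      \<open>m\<close> and the estimate speaks about \<open>a m\<close> for every large
      \<open>m\<close>.\<close>
    define s where "s n = (\<Sum>k\<le>n. p n k) - (\<Sum>k\<le>n div 2. p n k)" for n
    have s1: "s \<longlonglongrightarrow> 1 - 0" unfolding s_def by (intro tendsto_diff p_lim early)
    have "filterlim (\<lambda>m::nat. 2 * m) at_top sequentially"
      by (rule filterlim_subseq) (simp add: strict_mono_def)
    from filterlim_compose[OF s1 this] have s: "(\<lambda>m. s (2 * m)) \<longlonglongrightarrow> 1" by simp
    have "(\<lambda>m. s (2 * m) / (1 + e) * inverse (W (2 * m) / W m)) \<longlonglongrightarrow> 1 / (1 + e) * inverse 1"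
      using e by (intro tendsto_intros s sv) auto
    then have "\<forall>\<^sub>F m in sequentially. l < s (2 * m) / (1 + e) * inverse (W (2 * m) / W m)"
      using e(2) by (intro order_tendstoD) auto
    then show "\<forall>\<^sub>F n in sequentially. l < a n * W n"
      using eventually_ge_at_top[of K]
    proof eventually_elim
      case (elim m)
      have "s (2 * m) = (\<Sum>k\<in>{m<..2*m}. p (2 * m) k)"
        unfolding s_def by (subst sum_diff[symmetric]) (auto intro!: sum.cong)
      also have "\<dots> \<le> (\<Sum>k\<in>{m<..2*m}. (1 + e) * (a m * q (2 * m - k)))"
      proof (rule sum_mono)
        fix k assume k: "k \<in> {m<..2*m}"
        have "(1 + e) * (a k * q (2 * m - k)) \<le> (1 + e) * (a m * q (2 * m - k))"
          using k e q by (intro mult_left_mono mult_right_mono amono) auto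
        then show "p (2 * m) k \<le> (1 + e) * (a m * q (2 * m - k))"
          using K[of k "2 * m"] k elim by force
      qed
      also have "\<dots> \<le> (\<Sum>k\<in>{0..2*m}. (1 + e) * (a m * q (2 * m - k)))"
        using e a(1)[of m] q by (intro sum_mono2) auto
      also have "\<dots> = (1 + e) * (a m * W (2 * m))"
        unfolding sum_distrib_left[symmetric] Wrefl[OF le0] by simp
      finally have "s (2 * m) / (1 + e) \<le> a m * W (2 * m)"
        using e by (simp add: pos_divide_le_eq mult.commute)
      then have "s (2 * m) / (1 + e) * inverse (W (2 * m) / W m)
          \<le> a m * W (2 * m) * inverse (W (2 * m) / W m)"
        using Wpos[of m] Wpos[of "2 * m"] by (intro mult_right_mono) auto
      also have "\<dots> = a m * W m" using Wne by simp
      finally have "s (2 * m) / (1 + e) * inverse (W (2 * m) / W m) \<le> a m * W m" .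
      with elim show ?case by simp
    qed
  qed
  \<comment> \<open>Replacing \<open>n\<close> by \<open>n div 2\<close> in \<open>a\<close> does
    not change the asymptotics. Hence every value of \<open>a\<close> between these two indices is
    equivalent to \<open>1 / W n\<close>, uniformly.\<close>
  have aW': "(\<lambda>n. a (n div 2) * W n) \<longlonglongrightarrow> 1"
  proof -
    have "(\<lambda>n. (a (n div 2) * W (n div 2)) * (W n / W (n div 2))) \<longlonglongrightarrow> 1 * 1"
      by (intro tendsto_mult Whalf filterlim_compose[OF aW half])
    then show ?thesis using Wne by simp
  qed
  have a0: "a \<longlonglongrightarrow> 0"
  proof -
    have "(\<lambda>n. (a n * W n) / W n) \<longlonglongrightarrow> 0"
      by (rule tendsto_divide_0[OF aW filterlim_at_top_imp_at_infinity[OF Wtop]])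
    then show ?thesis using Wne by simp
  qed

  define J where "J n = {j. j \<le> n \<and> W j \<le> t * W n}" for n
  have tW: "0 \<le> t * W n" "t * W n < W n" for n using t Wpos[of n] by auto
  have V: "t * W n - q 0 \<le> (\<Sum>j\<in>J n. q j)" "(\<Sum>j\<in>J n. q j) \<le> t * W n" for n
    using sum_sublevel_bounds[OF q W tW] by (auto simp: J_def)
  \<comment> \<open>Since \<open>t < 1\<close> and \<open>W (n div 2)\<close> is equivalent to
    \<open>W n\<close>, the condition \<open>W j \<le> t * W n\<close> forces
    \<open>j < n div 2\<close>; the visit time \<open>n - j\<close> then lies in the second
    half.\<close>
  have Jsmall: "\<forall>\<^sub>F n in sequentially. \<forall>j\<in>J n. n div 2 \<le> n - j"
  proof -
    have "\<forall>\<^sub>F n in sequentially. W n / W (n div 2) < 1 / t"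
      using t by (intro order_tendstoD[OF Whalf]) auto
    then show ?thesis
    proof eventually_elim
      case (elim n)
      show ?case
      proof
        fix j assume j: "j \<in> J n"
        have "W j < W (n div 2)" using j elim t Wpos[of "n div 2"]
          by (auto simp: J_def field_simps)
        then have "j < n div 2" using Wmono[of "n div 2" j] by force
        then show "n div 2 \<le> n - j" by linarith
      qed
    qed
  qed
  \<comment> \<open>For \<open>j\<close> in \<open>J n\<close> the value \<open>a (n - j)\<close>
    lies between \<open>a n\<close> and \<open>a (n div 2)\<close>, and by \<open>V\<close> the sum
    of \<open>q\<close> over \<open>J n\<close> is \<open>t * W n\<close> up to \<open>q 0\<close>.
    The error \<open>a n * q 0\<close> vanishes because \<open>a\<close> tends to 0.\<close>
  have "(\<lambda>n. \<Sum>j\<in>J n. p n (n - j)) \<longlonglongrightarrow> t"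
  proof (rule order_tendstoI)
    fix u assume u: "t < u"
    define e where "e = (u - t) / (2 * t)"
    have e: "0 < e" "(1 + e) * t < u" using u t by (auto simp: e_def field_simps)
    obtain K where K: "\<And>n k. K \<le> k \<Longrightarrow> k \<le> n \<Longrightarrow>
        p n k \<le> (1 + e) * (a k * q (n - k))" using p_asymp[OF e(1)] by blast
    have "(\<lambda>n. (1 + e) * t * (a (n div 2) * W n)) \<longlonglongrightarrow> (1 + e) * t * 1"
      by (intro tendsto_mult tendsto_const aW')
    then have "\<forall>\<^sub>F n in sequentially. (1 + e) * t * (a (n div 2) * W n) < u"
      using e by (intro order_tendstoD) auto
    then show "\<forall>\<^sub>F n in sequentially. (\<Sum>j\<in>J n. p n (n - j)) < u"
      using Jsmall eventually_ge_at_top[of "2 * K"]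
    proof eventually_elim
      case (elim n)
      have "(\<Sum>j\<in>J n. p n (n - j)) \<le> (\<Sum>j\<in>J n. (1 + e) * (a (n div 2) * q j))"
      proof (rule sum_mono)
        fix j assume j: "j \<in> J n"
        have le: "n div 2 \<le> n - j" "j \<le> n" using elim j by (auto simp: J_def)
        have "p n (n - j) \<le> (1 + e) * (a (n - j) * q j)"
          using K[of "n - j" n] le elim by simp
        also have "\<dots> \<le> (1 + e) * (a (n div 2) * q j)"
          using le e q by (intro mult_left_mono mult_right_mono amono) auto
        finally show "p n (n - j) \<le> (1 + e) * (a (n div 2) * q j)" .
      qed
      also have "\<dots> = (1 + e) * (a (n div 2) * (\<Sum>j\<in>J n. q j))"
        by (simp add: sum_distrib_left)
      also have "\<dots> \<le> (1 + e) * (a (n div 2) * (t * W n))"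
        using e a(1)[of "n div 2"] V(2)[of n] by (intro mult_left_mono) auto
      also have "\<dots> = (1 + e) * t * (a (n div 2) * W n)" by simp
      finally show ?case using elim by simp
    qed
  next
    fix l assume l: "l < t"
    define e where "e = min (1/2) ((t - l) / (2 * t))"
    have e: "0 < e" "e < 1" "l < (1 - e) * t"
    proof -
      have "e * t \<le> (t - l) / (2 * t) * t"
        unfolding e_def using t by (intro mult_right_mono) auto
      also have "\<dots> = (t - l) / 2" using t by simp
      finally show "l < (1 - e) * t" using l by (simp add: left_diff_distrib)
    qed (use l t in \<open>auto simp: e_def\<close>)
    obtain K where K: "\<And>n k. K \<le> k \<Longrightarrow> k \<le> n \<Longrightarrow>
        (1 - e) * (a k * q (n - k)) \<le> p n k" using p_asymp[OF e(1)] by blast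
    have "(\<lambda>n. (1 - e) * (t * (a n * W n) - a n * q 0)) \<longlonglongrightarrow> (1 - e) * (t * 1 - 0 * q 0)"
      by (intro tendsto_intros aW a0)
    then have "\<forall>\<^sub>F n in sequentially. l < (1 - e) * (t * (a n * W n) - a n * q 0)"
      using e by (intro order_tendstoD) auto
    then show "\<forall>\<^sub>F n in sequentially. l < (\<Sum>j\<in>J n. p n (n - j))"
      using Jsmall eventually_ge_at_top[of "2 * K"]
    proof eventually_elim
      case (elim n)
      have "(1 - e) * (t * (a n * W n) - a n * q 0) = (1 - e) * (a n * (t * W n - q 0))"
        by (simp add: algebra_simps)
      also have "\<dots> \<le> (1 - e) * (a n * (\<Sum>j\<in>J n. q j))"
        using e a(1)[of n] V(1)[of n] by (intro mult_left_mono) auto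
      also have "\<dots> = (\<Sum>j\<in>J n. (1 - e) * (a n * q j))"
        by (simp add: sum_distrib_left)
      also have "\<dots> \<le> (\<Sum>j\<in>J n. p n (n - j))"
      proof (rule sum_mono)
        fix j assume j: "j \<in> J n"
        have le: "n div 2 \<le> n - j" "j \<le> n" using elim j by (auto simp: J_def)
        have "(1 - e) * (a n * q j) \<le> (1 - e) * (a (n - j) * q j)"
          using le e q by (intro mult_left_mono mult_right_mono amono) auto
        also have "\<dots> \<le> p n (n - j)"
          using K[of "n - j" n] le elim by simp
        finally show "(1 - e) * (a n * q j) \<le> p n (n - j)" .
      qed
      finally show ?case using elim by simp
    qed
  qed
  then show ?thesis by (simp add: J_def)
qed

subsection \<open>Weak-star cluster points\<close>

text \<open>Tychonoff: the functions \<open>H n\<close> lie in a product of compact intervals, so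
  their image filter has a cluster point \<open>L\<close>. The filter \<open>G\<close> joins
  \<open>F\<close> with the preimages of the neighborhoods of \<open>L\<close>. Filters take the
  place of subsequences, since the index type of the product may be uncountable.\<close>

lemma pointwise_convergent_subfilter:
  fixes H :: "'n \<Rightarrow> 'i \<Rightarrow> real"
  assumes F: "F \<noteq> bot" and bound: "\<And>n i. \<bar>H n i\<bar> \<le> B i"
  obtains G L where "G \<le> F" "G \<noteq> bot" "\<And>i. ((\<lambda>n. H n i) \<longlongrightarrow> L i) G"
proof -
  define K where "K = PiE UNIV (\<lambda>i. {- B i..B i})"
  have "compactin (product_topology (\<lambda>_. euclidean) UNIV) K"
    unfolding K_def by (subst compactin_PiE) (simp add: compactin_euclidean_iff)
  then have "compact K"
    by (simp add: euclidean_product_topology compactin_euclidean_iff)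
  moreover have "\<forall>\<^sub>F x in filtermap H F. x \<in> K"
    using bound unfolding eventually_filtermap K_def
    by (intro always_eventually allI) (auto simp: PiE_UNIV_domain abs_le_iff minus_le_iff)
  moreover have "filtermap H F \<noteq> bot" using F by (simp add: filtermap_bot_iff)
  ultimately obtain L where L: "inf (nhds L) (filtermap H F) \<noteq> bot"
    unfolding compact_filter by blast
  define G where "G = inf (filtercomap H (nhds L)) F"
  have "G \<noteq> bot"
  proof
    assume "G = bot"
    then have "eventually (\<lambda>_. False) G" by simp
    then obtain P Q where PQ: "eventually P (nhds L)" "eventually Q F" "\<And>n. P (H n) \<Longrightarrow> Q n \<Longrightarrow> False"
      unfolding G_def eventually_inf eventually_filtercomap by metis
    have "eventually (\<lambda>y. \<not> P y) (filtermap H F)"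
      unfolding eventually_filtermap using PQ(2) by (rule eventually_mono) (use PQ(3) in blast)
    with PQ(1) have "eventually (\<lambda>_. False) (inf (nhds L) (filtermap H F))"
      unfolding eventually_inf by blast
    with L show False by (simp add: trivial_limit_def)
  qed
  moreover have "((\<lambda>n. H n i) \<longlongrightarrow> L i) G" for i
  proof -
    have lim: "filterlim H (nhds L) G"
      unfolding G_def by (rule filterlim_mono[OF filterlim_filtercomap]) auto
    show ?thesis
    proof (rule topological_tendstoI)
      fix S :: "real set" assume "open S" "L i \<in> S"
      then have "open ((\<lambda>f. f i) -` S)" "L \<in> (\<lambda>f. f i) -` S"
        using open_vimage[OF _ continuous_on_product_coordinates[of i]] by auto
      from topological_tendstoD[OF lim this] show "\<forall>\<^sub>F n in G. H n i \<in> S" by simp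
    qed
  qed
  moreover have "G \<le> F" by (simp add: G_def)
  ultimately show ?thesis using that by blast
qed

text \<open>Weak-star compactness of the unit ball of \<open>L\<^sub>\<infinity>\<close>: Tychonoff gives a positive functional
  dominated by the integral, and Radon--Nikodym represents it by a density.\<close>

lemma weak_star_cluster_finite:
  fixes h :: "'n \<Rightarrow> 'a \<Rightarrow> real"
  assumes "finite_measure N" and h[measurable]: "\<And>n. h n \<in> borel_measurable N"
    and h01: "\<And>n x. 0 \<le> h n x" "\<And>n x. h n x \<le> 1" and F: "F \<noteq> bot"
  obtains G D where "G \<le> F" "G \<noteq> bot" "D \<in> borel_measurable N" "\<And>x. 0 \<le> D x" "\<And>x. D x \<le> 1"
    "\<And>u. integrable N u \<Longrightarrow> ((\<lambda>n. \<integral>x. h n x * u x \<partial>N) \<longlongrightarrow> (\<integral>x. D x * u x \<partial>N)) G"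
proof -
  interpret finite_measure N by fact
  have inth: "integrable N (\<lambda>x. g x * u x)"
    if "integrable N u" "g \<in> borel_measurable N" "\<And>x. 0 \<le> g x" "\<And>x. g x \<le> 1"
    for g u :: "'a \<Rightarrow> real"
    using that by (intro Bochner_Integration.integrable_bound[OF that(1)])
      (auto simp: abs_mult intro!: AE_I2 mult_left_le_one_le)
  \<comment> \<open>Compactness is applied with all functions \<open>u\<close> as coordinates. The
    default 0 for nonintegrable \<open>u\<close> keeps every coordinate bounded.\<close>
  define H where "H n u = (if integrable N u then \<integral>x. h n x * u x \<partial>N else 0)" for n u
  have bd: "\<bar>H n u\<bar> \<le> (\<integral>x. \<bar>u x\<bar> \<partial>N)" for n u
  proof (cases "integrable N u")
    case True
    have "\<bar>\<integral>x. h n x * u x \<partial>N\<bar> \<le> (\<integral>x. \<bar>h n x * u x\<bar> \<partial>N)" by (rule integral_abs_bound)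
    also have "\<dots> \<le> (\<integral>x. \<bar>u x\<bar> \<partial>N)"
      using True h01 by (intro integral_mono integrable_abs inth)
        (auto simp: abs_mult intro!: mult_left_le_one_le)
    finally show ?thesis using True by (simp add: H_def)
  qed (simp add: H_def)
  obtain G L where G: "G \<le> F" "G \<noteq> bot" and L: "\<And>u. ((\<lambda>n. H n u) \<longlongrightarrow> L u) G"
    by (rule pointwise_convergent_subfilter[of F H, OF F bd]) (rule that)
  have lim: "((\<lambda>n. \<integral>x. h n x * u x \<partial>N) \<longlongrightarrow> L u) G" if "integrable N u" for u
    using L[of u] that by (simp add: H_def)
  have L_add: "L (\<lambda>x. u x + v x) = L u + L v" if uv: "integrable N u" "integrable N v" for u v
  proof (rule tendsto_unique[OF G(2)])
    have "(\<integral>x. h n x * (u x + v x) \<partial>N) = (\<integral>x. h n x * u x \<partial>N) + (\<integral>x. h n x * v x \<partial>N)" for n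
      using inth[OF uv(1) h h01] inth[OF uv(2) h h01] by (simp add: distrib_left)
    then show "((\<lambda>n. \<integral>x. h n x * (u x + v x) \<partial>N) \<longlongrightarrow> L u + L v) G"
      using tendsto_add[OF lim[OF uv(1)] lim[OF uv(2)]] by simp
  qed (use uv in \<open>auto intro: lim\<close>)
  have L_scale: "L (\<lambda>x. u x * c) = L u * c" if u: "integrable N u" for u c
  proof (rule tendsto_unique[OF G(2)])
    have "(\<integral>x. h n x * (u x * c) \<partial>N) = (\<integral>x. h n x * u x \<partial>N) * c" for n
      by (simp add: mult.assoc[symmetric])
    then show "((\<lambda>n. \<integral>x. h n x * (u x * c) \<partial>N) \<longlongrightarrow> L u * c) G"
      using tendsto_mult_right[OF lim[OF u]] by simp
  qed (use u in \<open>auto intro: lim\<close>)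
  have L_le: "0 \<le> L u \<and> L u \<le> (\<integral>x. u x \<partial>N)" if u: "integrable N u" "\<And>x. 0 \<le> u x" for u
  proof (intro conjI tendsto_lowerbound[OF lim[OF u(1)] _ G(2)] tendsto_upperbound[OF lim[OF u(1)] _ G(2)]
      always_eventually allI)
    show "0 \<le> (\<integral>x. h n x * u x \<partial>N)" for n using u h01 by simp
    show "(\<integral>x. h n x * u x \<partial>N) \<le> (\<integral>x. u x \<partial>N)" for n
      using u h01 by (intro integral_mono inth h) (auto intro!: mult_left_le_one_le)
  qed
  have L_abs: "\<bar>L u\<bar> \<le> (\<integral>x. \<bar>u x\<bar> \<partial>N)" if u: "integrable N u" for u
  proof -
    have "L u + L (\<lambda>x. \<bar>u x\<bar> - u x) = L (\<lambda>x. \<bar>u x\<bar>)" "L (\<lambda>x. \<bar>u x\<bar> + u x) = L (\<lambda>x. \<bar>u x\<bar>) + L u"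
      using u L_add[of u "\<lambda>x. \<bar>u x\<bar> - u x"] L_add[of "\<lambda>x. \<bar>u x\<bar>" u] by simp_all
    moreover have "0 \<le> L (\<lambda>x. \<bar>u x\<bar> - u x)" "0 \<le> L (\<lambda>x. \<bar>u x\<bar> + u x)"
      using L_le[of "\<lambda>x. \<bar>u x\<bar> - u x"] L_le[of "\<lambda>x. \<bar>u x\<bar> + u x"] u by auto
    moreover have "L (\<lambda>x. \<bar>u x\<bar>) \<le> (\<integral>x. \<bar>u x\<bar> \<partial>N)"
      using L_le[of "\<lambda>x. \<bar>u x\<bar>"] u by auto
    ultimately show ?thesis by linarith
  qed
  \<comment> \<open>Dominated convergence passes to \<open>L\<close> through the bound
    \<open>L_abs\<close>. This serves twice: for the countable additivity of the set function
    \<open>m\<close>, and for the limit step when the density is shown to represent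
    \<open>L\<close>.\<close>
  have L_cont: "(\<lambda>i. L (s i)) \<longlonglongrightarrow> L u"
    if s: "\<And>i. integrable N (s i)" and u: "integrable N u" and w: "integrable N w"
      and conv: "\<And>x. x \<in> space N \<Longrightarrow> (\<lambda>i. s i x) \<longlonglongrightarrow> u x"
      and bd: "\<And>i x. x \<in> space N \<Longrightarrow> \<bar>s i x\<bar> \<le> w x" for s :: "nat \<Rightarrow> 'a \<Rightarrow> real" and u w
  proof -
    note [measurable] = borel_measurable_integrable[OF s] borel_measurable_integrable[OF u]
    have "(\<lambda>i. \<integral>x. \<bar>s i x - u x\<bar> \<partial>N) \<longlonglongrightarrow> (\<integral>x. 0 \<partial>N)"
    proof (rule integral_dominated_convergence[where w="\<lambda>x. w x + \<bar>u x\<bar>"])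
      show "AE x in N. (\<lambda>i. \<bar>s i x - u x\<bar>) \<longlonglongrightarrow> 0"
        using conv by (intro AE_I2) (auto simp: LIM_zero_iff tendsto_rabs_zero_iff)
      show "AE x in N. norm \<bar>s i x - u x\<bar> \<le> w x + \<bar>u x\<bar>" for i
      proof (rule AE_I2)
        fix x assume "x \<in> space N"
        then show "norm \<bar>s i x - u x\<bar> \<le> w x + \<bar>u x\<bar>" using bd[of x i] by simp
      qed
    qed (use u w in auto)
    then have z: "(\<lambda>i. \<integral>x. \<bar>s i x - u x\<bar> \<partial>N) \<longlonglongrightarrow> 0" by simp
    have "(\<lambda>i. L (s i) - L u) \<longlonglongrightarrow> 0"
    proof (rule Lim_null_comparison[OF _ z])
      have "L (s i) = L (\<lambda>x. s i x - u x) + L u" for i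
        using L_add[of "\<lambda>x. s i x - u x" u] s u by simp
      then show "\<forall>\<^sub>F i in sequentially. norm (L (s i) - L u) \<le> (\<integral>x. \<bar>s i x - u x\<bar> \<partial>N)"
        using L_abs s u by simp
    qed
    then show ?thesis by (simp add: LIM_zero_iff)
  qed

  define m where "m B = ennreal (L (indicator B))" for B
  define \<nu> where "\<nu> = measure_of (space N) (sets N) m"
  have ind: "integrable N (indicator B :: 'a \<Rightarrow> real)" if "B \<in> sets N" for B
    using that by (simp add: emeasure_eq_measure)
  have L_zero: "L (\<lambda>_. 0) = 0" using L_le[of "\<lambda>_. 0"] by simp
  have "countably_additive (sets N) m"
  proof (rule countably_additiveI)
    fix A :: "nat \<Rightarrow> 'a set" assume A: "range A \<subseteq> sets N" "disjoint_family A" "\<Union> (range A) \<in> sets N"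
    define s where "s n x = (\<Sum>i<n. indicator (A i) x :: real)" for n x
    have As: "A i \<in> sets N" for i using A by auto
    have s: "integrable N (s n)" for n unfolding s_def using As by (intro Bochner_Integration.integrable_sum ind)
    have sums: "(\<lambda>i. indicator (A i) x :: real) sums indicator (\<Union> (range A)) x" for x
      using indicator_sums[of A x] A by (simp add: disjoint_family_on_def)
    have "(\<lambda>n. L (s n)) \<longlonglongrightarrow> L (indicator (\<Union> (range A)))"
    proof (rule L_cont[where w="\<lambda>_. 1"])
      show "(\<lambda>n. s n x) \<longlonglongrightarrow> indicator (\<Union> (range A)) x" for x
        using sums[of x] by (simp add: sums_def s_def)
      show "\<bar>s n x\<bar> \<le> 1" for n x
      proof -
        have "s n x \<le> (\<Sum>i. indicator (A i) x)"
          unfolding s_def by (intro sum_le_suminf sums_summable[OF sums]) auto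
        also have "\<dots> \<le> 1" unfolding sums_unique[OF sums[of x], symmetric] by (simp add: indicator_def)
        finally show ?thesis by (simp add: s_def sum_nonneg)
      qed
    qed (use s ind A in auto)
    moreover have "L (s n) = (\<Sum>i<n. L (indicator (A i)))" for n
    proof (induction n)
      case 0
      then show ?case by (simp add: s_def L_zero)
    next
      case (Suc n)
      have "s (Suc n) = (\<lambda>x. s n x + indicator (A n) x)" by (simp add: s_def fun_eq_iff)
      then show ?case using L_add[OF s ind[OF As], of n n] Suc by simp
    qed
    ultimately have "(\<lambda>i. L (indicator (A i))) sums L (indicator (\<Union> (range A)))"
      by (simp add: sums_def)
    then show "(\<Sum>i. m (A i)) = m (\<Union> (range A))"
      unfolding m_def using L_le ind As by (intro suminf_ennreal_eq) auto
  qed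
  moreover have "positive (sets N) m"
    by (simp add: positive_def m_def indicator_def[abs_def] L_zero)
  ultimately have em: "emeasure \<nu> B = m B" if "B \<in> sets N" for B
    unfolding \<nu>_def using that sets.space_closed sets.sigma_algebra_axioms
    by (intro emeasure_measure_of_sigma) auto
  have s\<nu>: "sets \<nu> = sets N" unfolding \<nu>_def by simp
  have m_le: "m B \<le> emeasure N B" if B: "B \<in> sets N" for B
    using L_le[OF ind[OF B]] B by (auto simp: m_def emeasure_eq_measure intro!: ennreal_leI)
  have fin: "finite_measure \<nu>"
    by standard (use em[of "space N"] s\<nu> in \<open>auto simp: sets_eq_imp_space_eq[OF s\<nu>] m_def\<close>)
  interpret \<nu>: finite_measure \<nu> by fact
  have ac: "absolutely_continuous N \<nu>"
    unfolding absolutely_continuous_def null_sets_def using em m_le s\<nu> by fastforce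
  obtain D where D: "D \<in> borel_measurable N" "AE x in N. RN_deriv N \<nu> x = ennreal (D x)"
      "AE x in \<nu>. 0 < D x" "\<And>x. 0 \<le> D x"
    by (rule real_RN_deriv[OF fin ac s\<nu>]) (rule that)
  note [measurable] = D(1)
  have "density N (RN_deriv N \<nu>) = density N (\<lambda>x. ennreal (D x))"
    by (intro density_cong) (use D(2) in auto)
  then have dN: "\<nu> = density N (\<lambda>x. ennreal (D x))"
    using density_RN_deriv[OF ac s\<nu>] by simp
  have D_ind: "integrable N (\<lambda>x. D x * indicator B x) \<and> (\<integral>x. D x * indicator B x \<partial>N) = L (indicator B)"
    if B[measurable]: "B \<in> sets N" for B
  proof -
    have "(\<integral>\<^sup>+x. ennreal (D x * indicator B x) \<partial>N) = (\<integral>\<^sup>+x. ennreal (D x) * indicator B x \<partial>N)"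
      by (intro nn_integral_cong) (auto split: split_indicator)
    also have "\<dots> = emeasure \<nu> B"
      unfolding dN by (simp add: emeasure_density)
    also have "\<dots> = ennreal (L (indicator B))" using em[OF B] by (simp add: m_def)
    finally have "has_bochner_integral N (\<lambda>x. D x * indicator B x) (L (indicator B))"
      using D(4) L_le[OF ind[OF B]] by (intro has_bochner_integral_nn_integral) auto
    then show ?thesis by (auto simp: has_bochner_integral_iff)
  qed
  \<comment> \<open>On the set where \<open>D\<close> exceeds 1, the integral of
    \<open>D - 1\<close> is \<open>L\<close> of the indicator minus the mass of the set, which is at
    most 0; the integrand is nonnegative, so it vanishes almost everywhere.\<close>
  have D1: "AE x in N. D x \<le> 1"
  proof -
    define B where "B = {x \<in> space N. 1 < D x}"
    have B[measurable]: "B \<in> sets N" unfolding B_def by measurable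
    have int: "integrable N (\<lambda>x. D x * indicator B x - indicator B x)"
      using D_ind[OF B] ind[OF B] by auto
    have nn: "AE x in N. 0 \<le> D x * indicator B x - indicator B x"
      by (intro AE_I2) (auto simp: B_def indicator_def)
    have "(\<integral>x. D x * indicator B x - indicator B x \<partial>N) = L (indicator B) - (\<integral>x. indicator B x \<partial>N)"
      using D_ind[OF B] ind[OF B] by simp
    then have "(\<integral>x. D x * indicator B x - indicator B x \<partial>N) \<le> 0"
      using L_le[OF ind[OF B]] by simp
    then have "(\<integral>x. D x * indicator B x - indicator B x \<partial>N) = 0"
      using integral_nonneg_AE[OF nn] by simp
    then have "AE x in N. D x * indicator B x - indicator B x = 0"
      using integral_nonneg_eq_0_iff_AE[OF int nn] by simp
    then show ?thesis using AE_space by eventually_elim (auto simp: B_def indicator_def)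
  qed
  \<comment> \<open>Truncation changes \<open>D\<close> only on a null set and makes the bound by 1
    hold everywhere.\<close>
  define D' where "D' x = min 1 (D x)" for x
  have D'[measurable]: "D' \<in> borel_measurable N" and D'01: "\<And>x. 0 \<le> D' x" "\<And>x. D' x \<le> 1"
    using D(4) by (auto simp: D'_def[abs_def])
  have rep: "(\<integral>x. D' x * u x \<partial>N) = L u" if "integrable N u" for u
    using that
  proof (induction rule: integrable_induct)
    case (base B c)
    have "(\<integral>x. D' x * (indicator B x *\<^sub>R c) \<partial>N) = (\<integral>x. (D x * indicator B x) * c \<partial>N)"
      using base(1) D1 by (intro integral_cong_AE) (auto simp: D'_def)
    also have "\<dots> = L (indicator B) * c" using D_ind[OF base(1)] by simp
    also have "\<dots> = L (\<lambda>x. indicator B x * c)" using L_scale[OF ind[OF base(1)]] by simp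
    finally show ?case by simp
  next
    case (add f g)
    then show ?case
      using inth[OF add(1) D' D'01] inth[OF add(2) D' D'01] by (simp add: distrib_left L_add)
  next
    case (lim f s)
    have "(\<lambda>i. L (s i)) \<longlonglongrightarrow> L f"
      by (rule L_cont[where w="\<lambda>x. 2 * norm (f x)"]) (use lim in auto)
    moreover have "(\<lambda>i. \<integral>x. D' x * s i x \<partial>N) \<longlonglongrightarrow> (\<integral>x. D' x * f x \<partial>N)"
    proof (rule integral_dominated_convergence[where w="\<lambda>x. 2 * norm (f x)"])
      show "AE x in N. norm (D' x * s i x) \<le> 2 * norm (f x)" for i
      proof (rule AE_I2)
        fix x assume "x \<in> space N"
        then have "norm (s i x) \<le> 2 * norm (f x)" by (rule lim)
        moreover have "norm (D' x * s i x) \<le> norm (s i x)"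
          using D'01[of x] by (simp add: abs_mult mult_left_le_one_le)
        ultimately show "norm (D' x * s i x) \<le> 2 * norm (f x)" by linarith
      qed
    qed (use lim in \<open>auto intro!: AE_I2 tendsto_mult\<close>)
    ultimately show ?case using lim(5) by (simp add: LIMSEQ_unique)
  qed
  show ?thesis
    by (rule that[OF G D' D'01]) (simp add: rep lim)
qed

text \<open>Reweighting \<open>M\<close> by a strictly positive function of finite integral gives a
  finite measure \<open>N\<close> with the same null sets. Every absolutely continuous probability
  measure then has an \<open>N\<close>-integrable density, so the finite case applies with that
  density as test function.\<close>

lemma weak_star_cluster:
  fixes h :: "'n \<Rightarrow> 'a \<Rightarrow> real"
  assumes "sigma_finite_measure M" and h[measurable]: "\<And>n. h n \<in> borel_measurable M"
    and h01: "\<And>n x. 0 \<le> h n x" "\<And>n x. h n x \<le> 1" and F: "F \<noteq> bot"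
  obtains G D where "G \<le> F" "G \<noteq> bot" "D \<in> borel_measurable M" "\<And>x. 0 \<le> D x" "\<And>x. D x \<le> 1"
    "\<And>\<nu>. \<nu> \<in> ac_prob_measures M \<Longrightarrow> ((\<lambda>n. \<integral>x. h n x \<partial>\<nu>) \<longlongrightarrow> (\<integral>x. D x \<partial>\<nu>)) G"
proof -
  interpret sigma_finite_measure M by fact
  obtain g where g[measurable]: "g \<in> borel_measurable M" and gfin: "integral\<^sup>N M g \<noteq> \<infinity>"
    and gpos: "\<And>x. x \<in> space M \<Longrightarrow> 0 < g x"
    using Ex_finite_integrable_function by blast
  define N where "N = density M g"
  have sN: "sets N = sets M" and spN: "space N = space M" by (simp_all add: N_def)
  have "emeasure N (space N) = integral\<^sup>N M g"
    unfolding N_def by (simp add: emeasure_density cong: nn_integral_cong)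
  then have fin: "finite_measure N" using gfin by (intro finite_measureI) auto
  interpret N: finite_measure N by fact
  have hN: "h n \<in> borel_measurable N" for n
    using h measurable_cong_sets[OF sN refl] by blast
  obtain G D where G: "G \<le> F" "G \<noteq> bot" and D: "D \<in> borel_measurable N" "\<And>x. 0 \<le> D x" "\<And>x. D x \<le> 1"
    and lim: "\<And>u. integrable N u \<Longrightarrow> ((\<lambda>n. \<integral>x. h n x * u x \<partial>N) \<longlongrightarrow> (\<integral>x. D x * u x \<partial>N)) G"
    using weak_star_cluster_finite[of N h, OF fin hN h01 F] by blast
  have "((\<lambda>n. \<integral>x. h n x \<partial>\<nu>) \<longlongrightarrow> (\<integral>x. D x \<partial>\<nu>)) G" if \<nu>: "\<nu> \<in> ac_prob_measures M" for \<nu>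
  proof -
    interpret \<nu>: prob_space \<nu> using \<nu> by (simp add: ac_prob_measures_def)
    have s\<nu>: "sets \<nu> = sets N" and acM: "absolutely_continuous M \<nu>"
      using \<nu> by (simp_all add: ac_prob_measures_def sN)
    have ac: "absolutely_continuous N \<nu>"
      unfolding absolutely_continuous_def
    proof
      fix B assume "B \<in> null_sets N"
      then have B: "B \<in> sets M" and g0: "AE x in M. x \<in> B \<longrightarrow> g x = 0"
        by (simp_all add: N_def null_sets_density_iff)
      from g0 AE_space have "AE x in M. x \<notin> B"
        by eventually_elim (metis gpos less_irrefl)
      then have "B \<in> null_sets M" using B by (simp add: AE_iff_null_sets)
      then show "B \<in> null_sets \<nu>" using acM by (auto simp: absolutely_continuous_def)
    qed
    obtain u where u[measurable]: "u \<in> borel_measurable N" "AE x in N. RN_deriv N \<nu> x = ennreal (u x)"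
        "AE x in \<nu>. 0 < u x" "\<And>x. 0 \<le> u x"
      by (rule N.real_RN_deriv[OF \<nu>.finite_measure_axioms ac s\<nu>]) (rule that)
    have "density N (RN_deriv N \<nu>) = density N (\<lambda>x. ennreal (u x))"
      by (intro density_cong) (use u(2) in auto)
    then have d\<nu>: "\<nu> = density N (\<lambda>x. ennreal (u x))"
      using N.density_RN_deriv[OF ac s\<nu>] by simp
    have int: "(\<integral>x. k x \<partial>\<nu>) = (\<integral>x. k x * u x \<partial>N)" if [measurable]: "k \<in> borel_measurable N" for k :: "'a \<Rightarrow> real"
      unfolding d\<nu> using u(4) by (subst integral_density) (auto simp: mult.commute)
    have "integrable (density N (\<lambda>x. ennreal (u x))) (\<lambda>_. 1::real)"
      unfolding d\<nu>[symmetric] by simp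
    then have "integrable N u"
      using u(4) by (subst (asm) integrable_density) auto
    from lim[OF this] show ?thesis using int[OF hN] int[OF D(1)] by simp
  qed
  moreover have "D \<in> borel_measurable M" using D(1) measurable_cong_sets[OF sN refl] by blast
  ultimately show ?thesis by (intro that[of G D] G D)
qed

text \<open>Compactness reduces convergence to identifying all cluster points. If convergence
  failed, infinitely many indices would keep a distance \<open>e\<close> from \<open>c\<close>, and
  a cluster point along the filter restricted to these indices would contradict
  \<open>cluster\<close>.\<close>

lemma weak_star_limitI:
  fixes h :: "nat \<Rightarrow> 'a \<Rightarrow> real"
  assumes "sigma_finite_measure M" and h: "\<And>n. h n \<in> borel_measurable M"
    and h01: "\<And>n x. 0 \<le> h n x" "\<And>n x. h n x \<le> 1" and \<nu>: "\<nu> \<in> ac_prob_measures M"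
    and cluster: "\<And>G D. G \<le> sequentially \<Longrightarrow> G \<noteq> bot \<Longrightarrow> D \<in> borel_measurable M \<Longrightarrow>
      (\<And>x. 0 \<le> D x) \<Longrightarrow> (\<And>x. D x \<le> 1) \<Longrightarrow>
      (\<And>\<kappa>. \<kappa> \<in> ac_prob_measures M \<Longrightarrow> ((\<lambda>n. \<integral>x. h n x \<partial>\<kappa>) \<longlongrightarrow> (\<integral>x. D x \<partial>\<kappa>)) G) \<Longrightarrow>
      (\<integral>x. D x \<partial>\<nu>) = c"
  shows "(\<lambda>n. \<integral>x. h n x \<partial>\<nu>) \<longlonglongrightarrow> c"
proof (rule ccontr)
  assume "\<not> ?thesis"
  then obtain e where e: "0 < e" "\<not> (\<forall>\<^sub>F n in sequentially. dist (\<integral>x. h n x \<partial>\<nu>) c < e)"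
    unfolding tendsto_iff by blast
  define bad where "bad = {n. \<not> dist (\<integral>x. h n x \<partial>\<nu>) c < e}"
  define F where "F = inf sequentially (principal bad)"
  have "F \<noteq> bot"
    using e(2) by (simp add: F_def bad_def trivial_limit_def eventually_inf_principal)
  from weak_star_cluster[of M h, OF assms(1) h h01 this]
  obtain G D where G: "G \<le> F" "G \<noteq> bot" and D: "D \<in> borel_measurable M" "\<And>x. 0 \<le> D x" "\<And>x. D x \<le> 1"
    and lim: "\<And>\<kappa>. \<kappa> \<in> ac_prob_measures M \<Longrightarrow> ((\<lambda>n. \<integral>x. h n x \<partial>\<kappa>) \<longlongrightarrow> (\<integral>x. D x \<partial>\<kappa>)) G"
    by metis
  have "G \<le> sequentially" using G(1) by (simp add: F_def)
  from cluster[OF this G(2) D lim] have "(\<integral>x. D x \<partial>\<nu>) = c" .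
  with lim[OF \<nu>] have "\<forall>\<^sub>F n in G. dist (\<integral>x. h n x \<partial>\<nu>) c < e"
    using e(1) by (simp add: tendsto_iff)
  moreover have "\<forall>\<^sub>F n in G. n \<in> bad"
    using G(1) by (simp add: F_def le_principal)
  ultimately have "\<forall>\<^sub>F n in G. False" by eventually_elim (simp add: bad_def)
  with G(2) show False by (simp add: trivial_limit_def)
qed

text \<open>If the inequality failed on a set of positive measure, the normalized restriction of
  \<open>M\<close> to a part of that set with finite positive measure would be an absolutely
  continuous probability measure violating \<open>le\<close>. The bound \<open>b\<close> makes both
  integrals exist.\<close>

lemma AE_le_if_integral_le:
  fixes u v :: "'a \<Rightarrow> real"
  assumes "sigma_finite_measure M" and [measurable]: "u \<in> borel_measurable M" "v \<in> borel_measurable M"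
    and bd: "\<And>x. \<bar>u x\<bar> \<le> b" "\<And>x. \<bar>v x\<bar> \<le> b"
    and le: "\<And>\<nu>. \<nu> \<in> ac_prob_measures M \<Longrightarrow> (\<integral>x. u x \<partial>\<nu>) \<le> (\<integral>x. v x \<partial>\<nu>)"
  shows "AE x in M. u x \<le> v x"
proof (rule ccontr)
  interpret sigma_finite_measure M by fact
  define B where "B = {x \<in> space M. v x < u x}"
  have B[measurable]: "B \<in> sets M" unfolding B_def by measurable
  assume nAE: "\<not> ?thesis"
  obtain E :: "nat \<Rightarrow> 'a set" where E: "range E \<subseteq> sets M" "(\<Union>i. E i) = space M"
      "\<And>i. emeasure M (E i) \<noteq> \<infinity>"
    using sigma_finite by blast
  have [measurable]: "E i \<in> sets M" for i using E by auto
  have "\<exists>i. B \<inter> E i \<notin> null_sets M"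
  proof (rule ccontr)
    assume "\<not> ?thesis"
    then have "(\<Union>i. B \<inter> E i) \<in> null_sets M" by blast
    moreover have "(\<Union>i. B \<inter> E i) = B" using E(2) by (auto simp: B_def)
    ultimately have "AE x in M. x \<notin> B" by (simp add: AE_iff_null_sets[symmetric])
    then have "AE x in M. u x \<le> v x" using AE_space by eventually_elim (auto simp: B_def)
    with nAE show False by blast
  qed
  then obtain i where i: "B \<inter> E i \<notin> null_sets M" by blast
  define C where "C = B \<inter> E i"
  have C[measurable]: "C \<in> sets M" by (simp add: C_def)
  have C0: "emeasure M C \<noteq> 0" using i by (auto simp: C_def null_sets_def)
  have "emeasure M C \<le> emeasure M (E i)" by (intro emeasure_mono) (auto simp: C_def)
  then have C1: "emeasure M C \<noteq> \<infinity>" using E(3)[of i] by (auto simp: top_unique)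
  define \<nu> where "\<nu> = uniform_measure M C"
  interpret \<nu>: prob_space \<nu> unfolding \<nu>_def by (rule prob_space_uniform_measure[OF C0 C1])
  have ac: "absolutely_continuous M \<nu>"
    unfolding \<nu>_def uniform_measure_def by (intro absolutely_continuousI_density) measurable
  then have "\<nu> \<in> ac_prob_measures M"
    using \<nu>.prob_space_axioms by (simp add: ac_prob_measures_def \<nu>_def)
  from le[OF this] have le': "(\<integral>x. u x \<partial>\<nu>) \<le> (\<integral>x. v x \<partial>\<nu>)" .
  have [measurable]: "u \<in> borel_measurable \<nu>" "v \<in> borel_measurable \<nu>" by (simp_all add: \<nu>_def)
  have int: "integrable \<nu> u" "integrable \<nu> v"
    using bd by (auto intro!: \<nu>.integrable_const_bound[where B=b])
  have AEC: "AE x in \<nu>. v x < u x"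
    unfolding \<nu>_def using C0 C1 by (intro AE_uniform_measureI) (auto simp: C_def B_def)
  have nn: "AE x in \<nu>. 0 \<le> u x - v x" using AEC by eventually_elim simp
  have "(\<integral>x. u x - v x \<partial>\<nu>) \<le> 0" using le' int by simp
  then have "(\<integral>x. u x - v x \<partial>\<nu>) = 0" using integral_nonneg_AE[OF nn] by simp
  then have "AE x in \<nu>. u x - v x = 0"
    using integral_nonneg_eq_0_iff_AE[OF _ nn] int by simp
  with AEC have "AE x in \<nu>. False" by eventually_elim simp
  then show False by simp
qed

subsection \<open>Recurrence and strong convergence\<close>

locale conservative_ergodic_system = sigma_finite_measure M for M :: "'a measure" +
  fixes T :: "'a \<Rightarrow> 'a"
  assumes preserving: "measure_preserving M T"
    and conservative: "conservative M T"
    and ergodic: "ergodic M T"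
begin

lemma T_measurable[measurable]: "T \<in> measurable M M"
  using preserving by (simp add: measure_preserving_def)

lemma funpow_measurable[measurable]: "(T ^^ n) \<in> measurable M M"
  by (rule measurable_compose_n) (rule T_measurable)

lemma funpow_space: "x \<in> space M \<Longrightarrow> (T ^^ n) x \<in> space M"
  by (rule measurable_space[OF funpow_measurable])

lemma distr_funpow: "distr M M (T ^^ n) = M"
proof (induction n)
  case 0
  then show ?case using distr_id[of M] by (simp add: id_def)
next
  case (Suc n)
  have "distr M M T = M"
    using preserving by (intro measure_eqI) (auto simp: emeasure_distr measure_preserving_def)
  moreover have "distr M M (T ^^ Suc n) = distr (distr M M (T ^^ n)) M T"
    by (subst distr_distr) (simp_all add: comp_def)
  ultimately show ?case using Suc by metis
qed

lemma emeasure_vimage_funpow: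
  "B \<in> sets M \<Longrightarrow> emeasure M ((T ^^ n) -` B \<inter> space M) = emeasure M B"
  using emeasure_distr[OF funpow_measurable[of n], of B] by (simp add: distr_funpow)

lemma AE_funpow: "AE x in M. Q x \<Longrightarrow> AE x in M. Q ((T ^^ n) x)"
  using AE_distrD[OF funpow_measurable[of n], of Q] unfolding distr_funpow .

text \<open>Preimages of null sets are null because the measure is preserved. Testing against the
  pushed measure is how limits of functions are compared with limits of their compositions with
  iterates of \<open>T\<close>.\<close>

lemma ac_prob_distr_funpow:
  assumes \<nu>: "\<nu> \<in> ac_prob_measures M"
  shows "distr \<nu> M (T ^^ n) \<in> ac_prob_measures M"
proof -
  interpret prob_space \<nu> using \<nu> by (simp add: ac_prob_measures_def)
  have s: "sets \<nu> = sets M" "absolutely_continuous M \<nu>" using \<nu> by (simp_all add: ac_prob_measures_def)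
  have m: "(T ^^ n) \<in> measurable \<nu> M" by (simp add: measurable_cong_sets[OF s(1) refl])
  have "absolutely_continuous M (distr \<nu> M (T ^^ n))"
    unfolding absolutely_continuous_def
  proof
    fix B assume B: "B \<in> null_sets M"
    then have "(T ^^ n) -` B \<inter> space M \<in> null_sets M"
      by (auto simp: null_sets_def emeasure_vimage_funpow)
    then have "(T ^^ n) -` B \<inter> space M \<in> null_sets \<nu>"
      using s(2) by (auto simp: absolutely_continuous_def)
    then show "B \<in> null_sets (distr \<nu> M (T ^^ n))"
      using B m by (auto simp: null_sets_def emeasure_distr sets_eq_imp_space_eq[OF s(1)])
  qed
  then show ?thesis using prob_space_distr[OF m] by (simp add: ac_prob_measures_def)
qed

text \<open>Let \<open>C\<close> be the set of points whose orbit meets \<open>B\<close>, and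
  \<open>D\<close> the part of \<open>C\<close> that leaves \<open>C\<close> in one step.
  \<open>C\<close> is closed under going backwards in time, so an orbit passes \<open>D\<close> at
  most once; \<open>D\<close> is wandering and hence null. Thus \<open>C\<close> is invariant up to
  a null set, and by ergodicity it has full measure.\<close>

lemma recurrent:
  assumes B[measurable]: "B \<in> sets M" and pos: "emeasure M B \<noteq> 0"
  shows "AE x in M. \<exists>n. (T ^^ n) x \<in> B"
proof -
  define C where "C = {x \<in> space M. \<exists>n. (T ^^ n) x \<in> B}"
  have C[measurable]: "C \<in> sets M" unfolding C_def by measurable
  have C_back: "x \<in> C" if x: "T x \<in> C" "x \<in> space M" for x
  proof -
    obtain n where "(T ^^ n) (T x) \<in> B" using x(1) by (auto simp: C_def)
    then have "(T ^^ Suc n) x \<in> B" by (simp add: funpow_swap1)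
    then show ?thesis using x(2) unfolding C_def by blast
  qed
  have C_back_n: "x \<in> C" if "(T ^^ n) x \<in> C" "x \<in> space M" for x n
    using that
  proof (induction n)
    case (Suc n)
    have "(T ^^ n) x \<in> C" by (rule C_back) (use Suc.prems funpow_space in auto)
    then show ?case using Suc by blast
  qed simp
  define D where "D = C - (T -` C \<inter> space M)"
  have D[measurable]: "D \<in> sets M" unfolding D_def by measurable
  have no_return: "(T ^^ n) x \<notin> D" if x: "x \<in> space M" and m: "(T ^^ m) x \<in> D" and mn: "m < n" for x m n
  proof
    assume n: "(T ^^ n) x \<in> D"
    have "n = (n - Suc m) + Suc m" using mn by simp
    then have "(T ^^ n) x = (T ^^ (n - Suc m)) ((T ^^ Suc m) x)"
      by (metis comp_apply funpow_add)
    then have "(T ^^ Suc m) x \<in> C"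
      using n C_back_n[of "n - Suc m" "(T ^^ Suc m) x", OF _ funpow_space[OF x]] by (simp add: D_def)
    then show False using m x funpow_space[OF x, of m] by (auto simp: D_def)
  qed
  have "wandering M T D"
    unfolding wandering_def disjoint_family_on_def
  proof (intro conjI ballI impI D)
    fix m n :: nat assume "m \<noteq> n"
    then show "(T ^^ m) -` D \<inter> space M \<inter> ((T ^^ n) -` D \<inter> space M) = {}"
      using no_return[of _ m n] no_return[of _ n m] by (auto simp: neq_iff)
  qed
  then have "emeasure M D = 0" using conservative by (auto simp: conservative_def)
  then have "AE x in M. x \<notin> D" by (simp add: AE_iff_null_sets[symmetric] null_sets_def)
  from AE_funpow[OF this] have notD: "AE x in M. \<forall>n. (T ^^ n) x \<notin> D" by (simp add: AE_all_countable)
  \<comment> \<open>The definition of \<open>ergodic\<close> speaks of exactly invariant sets. The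
    points whose whole orbit stays in \<open>C\<close> form such a set, and it differs from
    \<open>C\<close> by a null set only.\<close>
  define E where "E = {x \<in> space M. \<forall>k. (T ^^ k) x \<in> C}"
  have E[measurable]: "E \<in> sets M" unfolding E_def by measurable
  have CE: "AE x in M. x \<in> C \<longrightarrow> x \<in> E"
    using notD AE_space
  proof eventually_elim
    case (elim x)
    have "(T ^^ k) x \<in> C" if "x \<in> C" for k
      using that
    proof (induction k)
      case (Suc k)
      have "T ((T ^^ k) x) \<in> C"
      proof (rule ccontr)
        assume "T ((T ^^ k) x) \<notin> C"
        then have "(T ^^ k) x \<in> D" using Suc.IH[OF Suc.prems] by (simp add: D_def)
        with elim(1) show False by simp
      qed
      then show ?case by simp
    qed simp
    then show ?case using elim by (auto simp: E_def)
  qed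
  have "T -` E \<inter> space M = E"
  proof (intro set_eqI iffI)
    fix x assume x: "x \<in> T -` E \<inter> space M"
    then have *: "(T ^^ Suc k) x \<in> C" for k by (simp add: E_def funpow_swap1)
    have "x \<in> C" by (rule C_back) (use *[of 0] x in simp_all)
    then have "(T ^^ k) x \<in> C" for k
      by (cases k) (simp, use *[of "k - 1"] in simp)
    then show "x \<in> E" using x by (auto simp: E_def)
  next
    fix x assume x: "x \<in> E"
    have "(T ^^ k) (T x) \<in> C" for k
    proof -
      have "(T ^^ Suc k) x \<in> C" using x unfolding E_def by blast
      then show ?thesis by (simp add: funpow_swap1)
    qed
    then show "x \<in> T -` E \<inter> space M"
      using x measurable_space[OF T_measurable] by (auto simp: E_def)
  qed
  then have "emeasure M E = 0 \<or> emeasure M (space M - E) = 0"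
    using ergodic E by (auto simp: ergodic_def)
  moreover have "emeasure M E \<noteq> 0"
  proof
    assume "emeasure M E = 0"
    then have "AE x in M. x \<notin> E" by (simp add: AE_iff_null_sets[symmetric] null_sets_def)
    with CE AE_space have "AE x in M. x \<notin> B"
    proof eventually_elim
      case (elim x)
      have "(T ^^ 0) x \<in> B" if "x \<in> B" using that by simp
      then show ?case using elim unfolding C_def by blast
    qed
    with pos show False by (simp add: AE_iff_null_sets[symmetric] null_sets_def)
  qed
  ultimately have "space M - E \<in> null_sets M" by (simp add: null_sets_def)
  from AE_not_in[OF this] show ?thesis using AE_space
  proof eventually_elim
    case (elim x)
    then have "(T ^^ 0) x \<in> C" unfolding E_def by blast
    then show ?case by (simp add: C_def)
  qed
qed

text \<open>\<open>D\<close> is constant along almost every orbit, and almost every orbit enters any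
  set of positive measure. So a range of values taken with positive measure is taken almost
  everywhere; \<open>D\<close> would lie strictly on one side of its mean if it did so with positive
  measure.\<close>

lemma AE_const_if_invariant:
  fixes D :: "'a \<Rightarrow> real"
  assumes [measurable]: "D \<in> borel_measurable M" and inv: "AE x in M. D (T x) = D x"
    and \<nu>: "\<nu> \<in> ac_prob_measures M" and int: "integrable \<nu> D"
  shows "AE x in M. D x = (\<integral>x. D x \<partial>\<nu>)"
proof -
  interpret \<nu>: prob_space \<nu> using \<nu> by (simp add: ac_prob_measures_def)
  have s: "sets \<nu> = sets M" "absolutely_continuous M \<nu>" using \<nu> by (simp_all add: ac_prob_measures_def)
  have inv_n: "AE x in M. \<forall>n. D ((T ^^ n) x) = D x"
  proof -
    have "AE x in M. \<forall>n. D (T ((T ^^ n) x)) = D ((T ^^ n) x)"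
      using AE_funpow[OF inv] by (simp add: AE_all_countable)
    then show ?thesis
    proof eventually_elim
      case (elim x)
      show ?case
      proof
        show "D ((T ^^ n) x) = D x" for n by (induction n) (simp_all add: elim)
      qed
    qed
  qed
  have spread: "AE x in M. D x \<in> S" if "S \<in> sets borel" "\<not> (AE x in M. D x \<notin> S)" for S
  proof -
    have [measurable]: "D -` S \<inter> space M \<in> sets M" using that by measurable
    have "emeasure M (D -` S \<inter> space M) \<noteq> 0"
    proof
      assume "emeasure M (D -` S \<inter> space M) = 0"
      then have "D -` S \<inter> space M \<in> null_sets M" by (simp add: null_sets_def)
      from AE_not_in[OF this] have "AE x in M. D x \<notin> S" using AE_space by eventually_elim auto
      with that show False by blast
    qed
    then have "AE x in M. \<exists>n. (T ^^ n) x \<in> D -` S \<inter> space M" by (intro recurrent) auto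
    with inv_n show ?thesis by eventually_elim force
  qed
  let ?c = "\<integral>x. D x \<partial>\<nu>"
  have "AE x in M. D x \<notin> {?c<..}"
  proof (rule ccontr)
    assume "\<not> ?thesis"
    then have "AE x in M. D x \<in> {?c<..}" by (intro spread) auto
    then have AE: "AE x in \<nu>. ?c < D x"
      using absolutely_continuous_AE[OF s] by simp
    show False
      using \<nu>.expectation_greater[OF int AE] by simp
  qed
  moreover have "AE x in M. D x \<notin> {..<?c}"
  proof (rule ccontr)
    assume "\<not> ?thesis"
    then have "AE x in M. D x \<in> {..<?c}" by (intro spread) auto
    then have AE: "AE x in \<nu>. D x < ?c"
      using absolutely_continuous_AE[OF s] by simp
    show False
      using \<nu>.expectation_less[OF int AE] by simp
  qed
  ultimately show ?thesis by eventually_elim auto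
qed

text \<open>Asymptotic invariance of \<open>h n\<close> makes every weak-star cluster point invariant, hence constant.\<close>

lemma strong_limit_if_asymptotically_invariant:
  fixes h :: "nat \<Rightarrow> 'a \<Rightarrow> real"
  assumes h[measurable]: "\<And>n. h n \<in> borel_measurable M"
    and h01: "\<And>n x. 0 \<le> h n x" "\<And>n x. h n x \<le> 1"
    and \<nu>0: "\<nu>0 \<in> ac_prob_measures M" and lim0: "(\<lambda>n. \<integral>x. h n x \<partial>\<nu>0) \<longlonglongrightarrow> c"
    and inv: "\<And>\<nu>. \<nu> \<in> ac_prob_measures M \<Longrightarrow>
      (\<lambda>n. (\<integral>x. h n (T x) \<partial>\<nu>) - (\<integral>x. h n x \<partial>\<nu>)) \<longlonglongrightarrow> 0"
    and \<nu>: "\<nu> \<in> ac_prob_measures M"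
  shows "(\<lambda>n. \<integral>x. h n x \<partial>\<nu>) \<longlonglongrightarrow> c"
proof (rule weak_star_limitI[OF sigma_finite_measure_axioms h h01 \<nu>])
  fix G D assume G: "G \<le> sequentially" "G \<noteq> bot" and D[measurable]: "D \<in> borel_measurable M"
    and D01: "\<And>x. 0 \<le> D x" "\<And>x. D x \<le> (1::real)"
    and lim: "\<And>\<kappa>. \<kappa> \<in> ac_prob_measures M \<Longrightarrow> ((\<lambda>n. \<integral>x. h n x \<partial>\<kappa>) \<longlongrightarrow> (\<integral>x. D x \<partial>\<kappa>)) G"
  \<comment> \<open>The integrals of \<open>h n\<close> composed with \<open>T\<close> have two
    limits along \<open>G\<close>: one by testing against the image of \<open>\<kappa>\<close> under
    \<open>T\<close>, the other from asymptotic invariance.\<close>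
  have eq: "(\<integral>x. D (T x) \<partial>\<kappa>) = (\<integral>x. D x \<partial>\<kappa>)" if \<kappa>: "\<kappa> \<in> ac_prob_measures M" for \<kappa>
  proof -
    have s: "sets \<kappa> = sets M" using \<kappa> by (simp add: ac_prob_measures_def)
    have T\<kappa>: "T \<in> measurable \<kappa> M" by (simp add: measurable_cong_sets[OF s refl])
    have "distr \<kappa> M T \<in> ac_prob_measures M" using ac_prob_distr_funpow[OF \<kappa>, of 1] by simp
    from lim[OF this]
    have "((\<lambda>n. \<integral>x. h n (T x) \<partial>\<kappa>) \<longlongrightarrow> (\<integral>x. D (T x) \<partial>\<kappa>)) G"
      by (simp add: integral_distr[OF T\<kappa>])
    moreover have "((\<lambda>n. \<integral>x. h n (T x) \<partial>\<kappa>) \<longlongrightarrow> (\<integral>x. D x \<partial>\<kappa>)) G"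
      using tendsto_add[OF tendsto_mono[OF G(1) inv[OF \<kappa>]] lim[OF \<kappa>]] by simp
    ultimately show ?thesis by (rule tendsto_unique[OF G(2)])
  qed
  have "AE x in M. D (T x) \<le> D x" "AE x in M. D x \<le> D (T x)"
    by (rule AE_le_if_integral_le[OF sigma_finite_measure_axioms, where b=1];
        use D01 eq in \<open>simp add: abs_le_iff\<close>)+
  then have "AE x in M. D (T x) = D x" by eventually_elim simp
  moreover have int: "integrable \<kappa> D" if \<kappa>: "\<kappa> \<in> ac_prob_measures M" for \<kappa>
  proof -
    interpret prob_space \<kappa> using \<kappa> by (simp add: ac_prob_measures_def)
    have s: "sets \<kappa> = sets M" using \<kappa> by (simp add: ac_prob_measures_def)
    show ?thesis using D01 D
      by (intro integrable_const_bound[where B=1]) (auto simp: measurable_cong_sets[OF s refl])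
  qed
  ultimately have "AE x in M. D x = (\<integral>x. D x \<partial>\<nu>0)"
    using AE_const_if_invariant[OF D _ \<nu>0] \<nu>0 by blast
  moreover have "(\<integral>x. D x \<partial>\<nu>0) = c"
    by (rule tendsto_unique[OF G(2) lim[OF \<nu>0] tendsto_mono[OF G(1) lim0]])
  ultimately have "AE x in M. D x = c" by simp
  then have AE\<nu>: "AE x in \<nu>. D x = c"
    using \<nu> by (auto simp: ac_prob_measures_def intro: absolutely_continuous_AE)
  interpret \<nu>: prob_space \<nu> using \<nu> by (simp add: ac_prob_measures_def)
  have "(\<integral>x. D x \<partial>\<nu>) = (\<integral>x. c \<partial>\<nu>)"
    using AE\<nu> int[OF \<nu>] by (intro integral_cong_AE) auto
  then show "(\<integral>x. D x \<partial>\<nu>) = c" by (simp add: \<nu>.prob_space)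
qed

text \<open>A cluster point of the indicators of \<open>T^(-n) A\<close> vanishes along almost every orbit under the first measure,
  so by recurrence it vanishes almost everywhere.\<close>

lemma strong_vanishing:
  assumes A[measurable]: "A \<in> sets M" and \<nu>0: "\<nu>0 \<in> ac_prob_measures M"
    and lim0: "(\<lambda>n. measure \<nu>0 ((T ^^ n) -` A \<inter> space M)) \<longlonglongrightarrow> 0"
    and \<nu>: "\<nu> \<in> ac_prob_measures M"
  shows "(\<lambda>n. measure \<nu> ((T ^^ n) -` A \<inter> space M)) \<longlonglongrightarrow> 0"
proof -
  define h :: "nat \<Rightarrow> 'a \<Rightarrow> real" where "h n = indicator ((T ^^ n) -` A \<inter> space M)" for n
  have h[measurable]: "h n \<in> borel_measurable M" for n unfolding h_def by measurable
  have h01: "0 \<le> h n x" "h n x \<le> 1" for n x by (simp_all add: h_def)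
  have h_shift: "h n ((T ^^ j) x) = h (n + j) x" if "x \<in> space M" for n j x
    using that funpow_space[OF that, of j] by (simp add: h_def funpow_add indicator_def)
  have h_int: "(\<integral>x. h n x \<partial>\<kappa>) = measure \<kappa> ((T ^^ n) -` A \<inter> space M)"
    if \<kappa>: "\<kappa> \<in> ac_prob_measures M" for n \<kappa>
  proof -
    interpret prob_space \<kappa> using \<kappa> by (simp add: ac_prob_measures_def)
    have s: "sets \<kappa> = sets M" using \<kappa> by (simp add: ac_prob_measures_def)
    have "(T ^^ n) -` A \<inter> space M \<in> sets \<kappa>" unfolding s by measurable
    then show ?thesis by (simp add: h_def)
  qed
  have "(\<lambda>n. \<integral>x. h n x \<partial>\<nu>) \<longlonglongrightarrow> 0"
  proof (rule weak_star_limitI[OF sigma_finite_measure_axioms h h01 \<nu>])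
    fix G D assume G: "G \<le> sequentially" "G \<noteq> bot" and D[measurable]: "D \<in> borel_measurable M"
      and D01: "\<And>x. 0 \<le> D x" "\<And>x. D x \<le> (1::real)"
      and lim: "\<And>\<kappa>. \<kappa> \<in> ac_prob_measures M \<Longrightarrow> ((\<lambda>n. \<integral>x. h n x \<partial>\<kappa>) \<longlongrightarrow> (\<integral>x. D x \<partial>\<kappa>)) G"
    interpret \<nu>0: prob_space \<nu>0 using \<nu>0 by (simp add: ac_prob_measures_def)
    have s: "sets \<nu>0 = sets M" "absolutely_continuous M \<nu>0"
      using \<nu>0 by (simp_all add: ac_prob_measures_def)
    note sp = sets_eq_imp_space_eq[OF s(1)]
    have m: "(T ^^ j) \<in> measurable \<nu>0 M" for j by (simp add: measurable_cong_sets[OF s(1) refl])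
    \<comment> \<open>Testing against the image of \<open>\<nu>0\<close> under \<open>T ^^ j\<close>
      turns \<open>h n\<close> into \<open>h (n + j)\<close>, whose integral under
      \<open>\<nu>0\<close> tends to 0. As \<open>D\<close> is nonnegative, its integral being 0
      makes it vanish.\<close>
    have D0: "AE x in \<nu>0. D ((T ^^ j) x) = 0" for j
    proof -
      have "((\<lambda>n. \<integral>x. h n ((T ^^ j) x) \<partial>\<nu>0) \<longlongrightarrow> (\<integral>x. D ((T ^^ j) x) \<partial>\<nu>0)) G"
        using lim[OF ac_prob_distr_funpow[OF \<nu>0, of j]] by (simp add: integral_distr[OF m])
      moreover have "(\<integral>x. h n ((T ^^ j) x) \<partial>\<nu>0) = (\<integral>x. h (n + j) x \<partial>\<nu>0)" for n
        by (intro Bochner_Integration.integral_cong) (auto simp: h_shift sp)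
      ultimately have "((\<lambda>n. \<integral>x. h (n + j) x \<partial>\<nu>0) \<longlongrightarrow> (\<integral>x. D ((T ^^ j) x) \<partial>\<nu>0)) G" by simp
      moreover have "((\<lambda>n. \<integral>x. h (n + j) x \<partial>\<nu>0) \<longlongrightarrow> 0) G"
        using LIMSEQ_ignore_initial_segment[OF lim0, of j]
        by (intro tendsto_mono[OF G(1)]) (simp add: h_int[OF \<nu>0])
      ultimately have zero: "(\<integral>x. D ((T ^^ j) x) \<partial>\<nu>0) = 0" by (rule tendsto_unique[OF G(2)])
      have "(\<lambda>x. D ((T ^^ j) x)) \<in> borel_measurable \<nu>0" using measurable_compose[OF m D] .
      then have "integrable \<nu>0 (\<lambda>x. D ((T ^^ j) x))"
        using D01 by (intro \<nu>0.integrable_const_bound[where B=1]) auto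
      then show ?thesis using zero integral_nonneg_eq_0_iff_AE[of \<nu>0 "\<lambda>x. D ((T ^^ j) x)"] D01 by simp
    qed
    then have D0': "AE x in \<nu>0. \<forall>j. D ((T ^^ j) x) = 0" by (simp add: AE_all_countable)
    define B where "B = {x \<in> space M. 0 < D x}"
    have B[measurable]: "B \<in> sets M" unfolding B_def by measurable
    have "emeasure M B = 0"
    proof (rule ccontr)
      assume "emeasure M B \<noteq> 0"
      from absolutely_continuous_AE[OF s recurrent[OF B this]] D0'
      have "AE x in \<nu>0. False" by eventually_elim (auto simp: B_def)
      then show False by simp
    qed
    then have "AE x in M. x \<notin> B" by (simp add: AE_iff_null_sets[symmetric] null_sets_def)
    then have "AE x in M. D x = 0"
      using AE_space by eventually_elim (use D01 in \<open>force simp: B_def not_less intro: antisym\<close>)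
    then have "AE x in \<nu>. D x = 0"
      using \<nu> by (auto simp: ac_prob_measures_def intro: absolutely_continuous_AE)
    then show "(\<integral>x. D x \<partial>\<nu>) = 0" by (rule integral_eq_zero_AE)
  qed
  then show ?thesis by (simp add: h_int[OF \<nu>])
qed

end

subsection \<open>The last visit to a set of finite measure\<close>

text \<open>A nonempty set of type \<open>enat\<close> attains its infimum. For a point that never
  returns the infimum is that of the empty set, namely infinity, and both sides hold.\<close>

lemma less_first_return_iff: "enat k < first_return T A x \<longleftrightarrow> (\<forall>j. 1 \<le> j \<longrightarrow> j \<le> k \<longrightarrow> (T ^^ j) x \<notin> A)"
proof -
  define S where "S = {enat n |n. 1 \<le> n \<and> (T ^^ n) x \<in> A}"
  have "enat k < Inf S \<longleftrightarrow> (\<forall>s\<in>S. enat k < s)"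
  proof (cases "S = {}")
    case True
    then show ?thesis by (simp add: Inf_enat_def)
  next
    case False
    then have "Inf S \<in> S" unfolding Inf_enat_def by (auto intro: LeastI)
    then show ?thesis by (auto intro: less_le_trans Inf_lower)
  qed
  then show ?thesis unfolding first_return_def S_def[symmetric] by (auto simp: S_def not_less[symmetric])
qed

text \<open>The step is an affine function of slope \<open>- 1 / (b - a)\<close> clamped to the unit
  interval, and clamping does not increase distances.\<close>

lemma cts_step_Lipschitz:
  assumes "a < b"
  shows "\<bar>cts_step a b x - cts_step a b y\<bar> \<le> \<bar>x - y\<bar> / (b - a)"
proof -
  have eq: "cts_step a b z = max 0 (min 1 ((b - z) / (b - a)))" for z
    using assms by (auto simp: cts_step_def field_simps max_def min_def)
  have "\<bar>cts_step a b x - cts_step a b y\<bar> \<le> \<bar>(b - x) / (b - a) - (b - y) / (b - a)\<bar>"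
    unfolding eq by linarith
  also have "(b - x) / (b - a) - (b - y) / (b - a) = (y - x) / (b - a)"
    by (simp add: diff_divide_distrib)
  finally show ?thesis using assms by (simp add: abs_minus_commute)
qed

section \<open>Probability densities and iterates of the transfer operator\<close>

lemma integrable_ac_prob_density:
  assumes "f \<in> ac_prob_densities M"
  shows "integrable M f"
proof -
  have f: "f \<in> borel_measurable M" "AE x in M. 0 \<le> f x"
      "prob_space (density M (\<lambda>x. ennreal (f x)))"
    using assms by (simp_all add: ac_prob_densities_def ac_prob_measures_def)
  interpret prob_space "density M (\<lambda>x. ennreal (f x))" by (rule f(3))
  have "integrable (density M (\<lambda>x. ennreal (f x))) (\<lambda>_. 1::real)" by simp
  then show ?thesis using f(1,2) by (subst (asm) integrable_density) auto
qed

lemma measure_ac_prob_density: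
  assumes "f \<in> ac_prob_densities M" and B[measurable]: "B \<in> sets M"
  shows "measure (density M (\<lambda>x. ennreal (f x))) B = set_lebesgue_integral M B f"
proof -
  have f[measurable]: "f \<in> borel_measurable M" "AE x in M. 0 \<le> f x"
    using assms by (simp_all add: ac_prob_densities_def)
  have "measure (density M (\<lambda>x. ennreal (f x))) B
      = (\<integral>x. indicator B x \<partial>density M (\<lambda>x. ennreal (f x)))"
    using sets.sets_into_space[OF B] by (simp add: Int_absorb2)
  also have "\<dots> = (\<integral>x. f x *\<^sub>R indicator B x \<partial>M)"
    by (rule integral_density) (use f in auto)
  also have "\<dots> = set_lebesgue_integral M B f"
    by (simp add: set_lebesgue_integral_def mult.commute)
  finally show ?thesis .
qed

context conservative_ergodic_system
begin

text \<open>Induction on \<open>k\<close> through the defining duality. Integrability is carried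
  along because the chosen version of the next iterate is known to satisfy the duality only when the
  current one is integrable.\<close>

lemma transfer_op_funpow:
  assumes f: "integrable M f"
  shows "integrable M ((transfer_op M T ^^ k) f) \<and> (\<forall>B\<in>sets M.
    set_lebesgue_integral M B ((transfer_op M T ^^ k) f)
      = set_lebesgue_integral M ((T ^^ k) -` B \<inter> space M) f)"
proof (induction k)
  case 0
  have "B \<inter> space M = B" if "B \<in> sets M" for B using sets.sets_into_space[OF that] by blast
  then show ?case using f by simp
next
  case (Suc k)
  let ?g = "(transfer_op M T ^^ k) f"
  have "\<exists>g. is_transfer M T ?g g"
    by (rule is_transfer_exists[OF sigma_finite_measure_axioms preserving]) (rule conjunct1[OF Suc])
  then have "is_transfer M T ?g (transfer_op M T ?g)"
    unfolding transfer_op_def by (rule someI_ex)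
  then have g: "integrable M (transfer_op M T ?g)"
      "\<And>B. B \<in> sets M \<Longrightarrow> set_lebesgue_integral M B (transfer_op M T ?g)
        = set_lebesgue_integral M (T -` B \<inter> space M) ?g"
    by (auto simp: is_transfer_def)
  have "set_lebesgue_integral M B (transfer_op M T ?g)
      = set_lebesgue_integral M ((T ^^ Suc k) -` B \<inter> space M) f" if B: "B \<in> sets M" for B
  proof -
    have "T -` B \<inter> space M \<in> sets M" using B by measurable
    moreover have "(T ^^ k) -` (T -` B \<inter> space M) \<inter> space M = (T ^^ Suc k) -` B \<inter> space M"
      using funpow_space by auto
    ultimately show ?thesis using g(2)[OF B] Suc by metis
  qed
  then show ?case using g(1) by (simp add: comp_def)
qed

end

section \<open>Decomposition of the space by the time of the last visit\<close>

locale finite_measure_section = conservative_ergodic_system M T for M :: "'a measure" and T +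
  fixes A :: "'a set"
  assumes A_sets[measurable]: "A \<in> sets M" and A_pos: "0 < emeasure M A"
    and A_finite: "emeasure M A < \<infinity>"
    and infinite: "emeasure M (space M) = \<infinity>"
begin

definition surviving :: "nat \<Rightarrow> 'a set" where
  "surviving k = A \<inter> {y \<in> space M. enat k < first_return T A y}"

text \<open>Outside the hit set the default value 0 of \<open>last_visit\<close> makes the age equal
  to \<open>n\<close>, the largest possible one.\<close>

abbreviation visit_age :: "nat \<Rightarrow> 'a \<Rightarrow> nat" where
  "visit_age n x \<equiv> n - last_visit M T A n x"

abbreviation rate :: "nat \<Rightarrow> real" where
  "rate \<equiv> wandering_rate M T A"

lemma A_space: "x \<in> A \<Longrightarrow> x \<in> space M"
  using sets.sets_into_space[OF A_sets] by blast

lemma surviving_iff: "x \<in> surviving k \<longleftrightarrow> x \<in> A \<and> (\<forall>j. 1 \<le> j \<longrightarrow> j \<le> k \<longrightarrow> (T ^^ j) x \<notin> A)"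
  using A_space by (auto simp: surviving_def less_first_return_iff)

lemma surviving_measurable[measurable]: "surviving k \<in> sets M"
  unfolding surviving_def less_first_return_iff by measurable

lemma surviving_antimono: "j \<le> k \<Longrightarrow> surviving k \<subseteq> surviving j"
  by (auto simp: surviving_iff)

lemma surviving_0: "surviving 0 = A"
  by (auto simp: surviving_iff)

lemma hit_set_iff: "x \<in> hit_set M T A n \<longleftrightarrow> x \<in> space M \<and> (\<exists>k\<le>n. (T ^^ k) x \<in> A)"
  by (auto simp: hit_set_def)

lemma hit_set_measurable[measurable]: "hit_set M T A n \<in> sets M"
  unfolding hit_set_def by measurable

lemma last_visit_eqI:
  assumes x: "x \<in> space M" and k: "k \<le> n" and s: "(T ^^ k) x \<in> surviving (n - k)"
  shows "x \<in> hit_set M T A n" "last_visit M T A n x = k"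
proof -
  show h: "x \<in> hit_set M T A n" using x k s by (auto simp: hit_set_iff surviving_iff)
  have "Max {k. k \<le> n \<and> (T ^^ k) x \<in> A} = k"
  proof (rule Max_eqI)
    show "finite {k. k \<le> n \<and> (T ^^ k) x \<in> A}" by simp
    show "k \<in> {k. k \<le> n \<and> (T ^^ k) x \<in> A}" using k s by (simp add: surviving_iff)
    fix j assume j: "j \<in> {k. k \<le> n \<and> (T ^^ k) x \<in> A}"
    show "j \<le> k"
    proof (rule ccontr)
      assume "\<not> j \<le> k"
      then have "j = (j - k) + k" and "1 \<le> j - k" and "j - k \<le> n - k" using j by auto
      then have "(T ^^ (j - k)) ((T ^^ k) x) \<notin> A" using s unfolding surviving_iff by blast
      moreover have "(T ^^ (j - k)) ((T ^^ k) x) = (T ^^ j) x"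
        using \<open>j = (j - k) + k\<close> by (metis comp_apply funpow_add)
      ultimately show False using j by simp
    qed
  qed
  then show "last_visit M T A n x = k" using h by (simp add: last_visit_def)
qed

lemma last_visit_surviving:
  assumes h: "x \<in> hit_set M T A n"
  shows "last_visit M T A n x \<le> n" "(T ^^ last_visit M T A n x) x \<in> surviving (visit_age n x)"
proof -
  let ?S = "{k. k \<le> n \<and> (T ^^ k) x \<in> A}"
  define k where "k = last_visit M T A n x"
  have fin: "finite ?S" and ne: "?S \<noteq> {}" using h by (auto simp: hit_set_iff)
  have k: "k = Max ?S" using h by (simp add: k_def last_visit_def)
  then have "k \<in> ?S" using Max_in[OF fin ne] by simp
  moreover have "(T ^^ j) ((T ^^ k) x) \<notin> A" if "1 \<le> j" "j \<le> n - k" for j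
  proof
    assume "(T ^^ j) ((T ^^ k) x) \<in> A"
    then have "j + k \<in> ?S" using that \<open>k \<in> ?S\<close> by (simp add: funpow_add)
    then have "j + k \<le> k" unfolding k using Max_ge[OF fin] by blast
    then show False using that by simp
  qed
  ultimately show "last_visit M T A n x \<le> n" "(T ^^ last_visit M T A n x) x \<in> surviving (visit_age n x)"
    by (auto simp: surviving_iff k_def[symmetric])
qed

lemma last_visit_le: "last_visit M T A n x \<le> n"
  using last_visit_surviving(1)[of x n] by (cases "x \<in> hit_set M T A n") (auto simp: last_visit_def)

text \<open>The last visit up to time \<open>n\<close> has age \<open>j\<close> exactly when the
  orbit is in \<open>A\<close> at time \<open>n - j\<close> and avoids \<open>A\<close> for the next
  \<open>j\<close> steps. Disjointness holds because the last visit is unique;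
  \<open>j \<le> n\<close> keeps the truncated subtraction faithful.\<close>

lemma last_visit_vimage:
  assumes J: "J \<subseteq> {..n}"
  shows "{x \<in> hit_set M T A n. visit_age n x \<in> J}
    = (\<Union>j\<in>J. (T ^^ (n - j)) -` surviving j \<inter> space M)" (is "?L = ?R")
    and "disjoint_family_on (\<lambda>j. (T ^^ (n - j)) -` surviving j \<inter> space M) J"
proof -
  have eq: "x \<in> hit_set M T A n \<and> last_visit M T A n x = n - j"
    if "j \<le> n" "x \<in> (T ^^ (n - j)) -` surviving j \<inter> space M" for x j
    using last_visit_eqI[of x "n - j" n] that by auto
  show "?L = ?R"
  proof (intro set_eqI iffI)
    fix x assume x: "x \<in> ?L"
    then have "(T ^^ (n - visit_age n x)) x \<in> surviving (visit_age n x)"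
      using last_visit_surviving[of x n] by simp
    then show "x \<in> ?R" using x by (auto simp: hit_set_iff)
  next
    fix x assume "x \<in> ?R"
    then obtain j where j: "j \<in> J" "x \<in> (T ^^ (n - j)) -` surviving j \<inter> space M" by blast
    moreover have "j \<le> n" using j(1) J by auto
    ultimately show "x \<in> ?L" using eq[of j x] by simp
  qed
  show "disjoint_family_on (\<lambda>j. (T ^^ (n - j)) -` surviving j \<inter> space M) J"
    unfolding disjoint_family_on_def
  proof (intro ballI impI)
    fix i j assume ij: "i \<in> J" "j \<in> J" "i \<noteq> j"
    then have "i \<le> n" "j \<le> n" using J by auto
    then show "(T ^^ (n - i)) -` surviving i \<inter> space M \<inter> ((T ^^ (n - j)) -` surviving j \<inter> space M) = {}"
      using eq[of i] eq[of j] ij(3) by fastforce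
  qed
qed

lemma hit_set_decomp: "hit_set M T A n = (\<Union>j\<in>{..n}. (T ^^ (n - j)) -` surviving j \<inter> space M)"
  using last_visit_vimage(1)[of "{..n}" n] by auto

lemma emeasure_surviving_finite: "emeasure M (surviving k) < top"
proof -
  have "emeasure M (surviving k) \<le> emeasure M A"
    by (intro emeasure_mono) (auto simp: surviving_iff)
  then show ?thesis using A_finite by (simp add: order_le_less_trans)
qed

text \<open>The hit set splits into preimages of the sets \<open>surviving j\<close> according to
  the age of the last visit, and each preimage has the measure of the set itself.\<close>

lemma rate_eq_sum: "rate n = (\<Sum>k\<le>n. measure M (surviving k))"
proof -
  have "rate n = (\<Sum>j\<le>n. measure M ((T ^^ (n - j)) -` surviving j \<inter> space M))"
    unfolding wandering_rate_def hit_set_decomp using last_visit_vimage(2)[of "{..n}" n]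
    by (intro measure_finite_Union) (auto simp: emeasure_vimage_funpow emeasure_surviving_finite less_imp_neq)
  then show ?thesis by (simp add: measure_def emeasure_vimage_funpow)
qed

lemma emeasure_hit_set: "emeasure M (hit_set M T A n) = ennreal (rate n)"
proof -
  have "emeasure M (hit_set M T A n) \<le> (\<Sum>j\<le>n. emeasure M ((T ^^ (n - j)) -` surviving j \<inter> space M))"
    unfolding hit_set_decomp by (intro emeasure_subadditive_finite) auto
  also have "\<dots> < \<infinity>"
    by (simp add: emeasure_vimage_funpow emeasure_surviving_finite)
  finally show ?thesis by (simp add: wandering_rate_def emeasure_eq_ennreal_measure)
qed

lemma surviving_measure_props:
  "0 \<le> measure M (surviving n)" "antimono (\<lambda>n. measure M (surviving n))"
  "0 < measure M (surviving 0)"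
proof -
  show "antimono (\<lambda>n. measure M (surviving n))"
    using surviving_antimono emeasure_surviving_finite
    by (intro antimonoI measure_mono_fmeasurable) (auto simp: fmeasurable_def)
  show "0 < measure M (surviving 0)"
    using A_pos A_finite by (simp add: surviving_0 measure_def enn2real_positive_iff less_top)
qed simp

lemma rate_pos: "0 < rate n"
  using surviving_measure_props(3) sum_mono2[of "{..n}" "{0}" "\<lambda>k. measure M (surviving k)"]
  by (simp add: rate_eq_sum)

lemma rate_mono: "m \<le> n \<Longrightarrow> rate m \<le> rate n"
  unfolding rate_eq_sum by (intro sum_mono2) auto

lemma AE_hit: "AE x in M. \<exists>n. x \<in> hit_set M T A n"
proof -
  have "AE x in M. \<exists>n. (T ^^ n) x \<in> A" using A_pos by (intro recurrent) auto
  with AE_space show ?thesis by eventually_elim (auto simp: hit_set_iff)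
qed

lemma incseq_hit_set: "incseq (hit_set M T A)"
  by (intro incseq_SucI) (meson hit_set_iff le_SucI subsetI)

text \<open>By recurrence the hit sets increase to the whole space up to a null set, and the space
  has infinite measure.\<close>

lemma rate_at_top: "filterlim rate at_top sequentially"
  unfolding filterlim_at_top_dense
proof
  fix Z
  have "emeasure M (space M) \<le> emeasure M (\<Union>n. hit_set M T A n)"
    using AE_hit by (intro emeasure_mono_AE) (auto elim: eventually_mono)
  then have "emeasure M (\<Union>n. hit_set M T A n) = \<infinity>" using infinite by (simp add: top_unique)
  moreover have "(\<lambda>n. emeasure M (hit_set M T A n)) \<longlonglongrightarrow> emeasure M (\<Union>n. hit_set M T A n)"
    by (intro Lim_emeasure_incseq incseq_hit_set) auto
  ultimately have "(\<lambda>n. ennreal (rate n)) \<longlonglongrightarrow> \<infinity>" by (simp add: emeasure_hit_set)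
  then have "\<forall>\<^sub>F n in sequentially. ennreal Z < ennreal (rate n)"
    by (intro order_tendstoD) auto
  then show "\<forall>\<^sub>F n in sequentially. Z < rate n"
    by eventually_elim (meson ennreal_leI not_less)
qed

lemma ac_prob_hit_set:
  assumes \<nu>: "\<nu> \<in> ac_prob_measures M"
  shows "(\<lambda>n. measure \<nu> (hit_set M T A n)) \<longlonglongrightarrow> 1"
proof -
  interpret prob_space \<nu> using \<nu> by (simp add: ac_prob_measures_def)
  have s: "sets \<nu> = sets M" "absolutely_continuous M \<nu>" using \<nu> by (simp_all add: ac_prob_measures_def)
  have "prob (\<Union>n. hit_set M T A n) = 1"
    using absolutely_continuous_AE[OF s AE_hit] by (subst prob_eq_1) (auto simp: s)
  moreover have "(\<lambda>n. prob (hit_set M T A n)) \<longlonglongrightarrow> prob (\<Union>n. hit_set M T A n)"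
    by (intro finite_Lim_measure_incseq incseq_hit_set) (auto simp: s)
  ultimately show ?thesis by simp
qed

text \<open>The points of \<open>A\<close> that never return to \<open>A\<close> form a wandering
  set, since an orbit through one of them cannot meet \<open>A\<close> again.\<close>

lemma AE_return: "AE x in M. \<exists>n. x \<notin> surviving n"
proof -
  define R where "R = (\<Inter>n. surviving n)"
  have R: "R \<in> sets M" unfolding R_def by measurable
  have "wandering M T R"
    unfolding wandering_def disjoint_family_on_def
  proof (intro conjI ballI impI R)
    have no: "(T ^^ n) x \<notin> R" if "(T ^^ m) x \<in> R" "m < n" for x and m n :: nat
    proof
      assume n: "(T ^^ n) x \<in> R"
      have "n = (n - m) + m" using that by simp
      then have "(T ^^ n) x = (T ^^ (n - m)) ((T ^^ m) x)" by (metis comp_apply funpow_add)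
      moreover have "(T ^^ m) x \<in> surviving (n - m)" using that by (auto simp: R_def)
      ultimately have "(T ^^ n) x \<notin> A" using that by (simp add: surviving_iff)
      then show False using n by (auto simp: R_def surviving_iff)
    qed
    fix m n :: nat assume "m \<noteq> n"
    then show "(T ^^ m) -` R \<inter> space M \<inter> ((T ^^ n) -` R \<inter> space M) = {}"
      using no[of m _ n] no[of n _ m] by (auto simp: neq_iff)
  qed
  then have "R \<in> null_sets M" using conservative R by (auto simp: conservative_def null_sets_def)
  from AE_not_in[OF this] show ?thesis by (simp add: R_def)
qed

text \<open>For fixed \<open>k\<close> these events decrease in \<open>n\<close> to the event that
  the orbit is in \<open>A\<close> at time \<open>k\<close> and never afterwards, which is null by
  \<open>AE_return\<close>.\<close>

lemma ac_prob_fixed_visit: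
  assumes \<nu>: "\<nu> \<in> ac_prob_measures M"
  shows "(\<lambda>n. measure \<nu> ((T ^^ k) -` surviving (n - k) \<inter> space M)) \<longlonglongrightarrow> 0"
proof -
  interpret prob_space \<nu> using \<nu> by (simp add: ac_prob_measures_def)
  have s: "sets \<nu> = sets M" "absolutely_continuous M \<nu>" using \<nu> by (simp_all add: ac_prob_measures_def)
  let ?S = "\<lambda>n. (T ^^ k) -` surviving (n - k) \<inter> space M"
  have "(\<lambda>n. prob (?S n)) \<longlonglongrightarrow> prob (\<Inter>n. ?S n)"
  proof (rule finite_Lim_measure_decseq)
    show "range ?S \<subseteq> sets \<nu>" unfolding s by auto
    show "decseq ?S"
    proof (rule decseq_SucI)
      fix n show "?S (Suc n) \<subseteq> ?S n"
        using surviving_antimono[of "n - k" "Suc n - k"] diff_le_mono[of n "Suc n" k] by auto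
    qed
  qed
  moreover have "AE x in \<nu>. x \<notin> (\<Inter>n. ?S n)"
    using absolutely_continuous_AE[OF s AE_funpow[OF AE_return, of k]]
  proof eventually_elim
    case (elim x)
    then obtain n where "(T ^^ k) x \<notin> surviving n" by blast
    then have "x \<notin> ?S (n + k)" by simp
    then show ?case by blast
  qed
  then have "prob (\<Inter>n. ?S n) = 0"
    by (subst prob_eq_0) (auto simp: s)
  ultimately show ?thesis by simp
qed

section \<open>The normalized spent time process and its near invariance under
  \<open>T\<close>\<close>

lemma spent_time_kac_eq: "spent_time_kac M T A n x = rate (visit_age n x) / rate n"
  unfolding spent_time_kac_def wandering_rate_def[symmetric] rate_eq_sum[of "visit_age n x"]
  by (simp add: surviving_def atMost_atLeast0)

lemma spent_time_kac_bounds: "0 < spent_time_kac M T A n x" "spent_time_kac M T A n x \<le> 1"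
  using rate_pos rate_mono[of "visit_age n x" n] by (auto simp: spent_time_kac_eq)

lemma spent_time_kac_measurable[measurable]: "spent_time_kac M T A n \<in> borel_measurable M"
proof -
  have "last_visit M T A n \<in> measurable M (count_space UNIV)"
    unfolding last_visit_def[abs_def] by measurable
  then have "(\<lambda>x. rate (n - last_visit M T A n x) / rate n) \<in> borel_measurable M" by measurable
  then show ?thesis by (simp add: spent_time_kac_eq[abs_def])
qed

text \<open>Off the hit set the age is \<open>n\<close> and the process equals 1, so for
  \<open>t < 1\<close> only points of the hit set count and the last-visit decomposition applies.
  The index \<open>n - (n - j)\<close> is kept in this form to match \<open>p n (n - j)\<close> in
  \<open>renewal_limit\<close>.\<close>

lemma spent_time_kac_sublevel:
  assumes \<nu>: "\<nu> \<in> ac_prob_measures M" and t: "t < 1"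
  shows "measure \<nu> {x \<in> space M. spent_time_kac M T A n x \<le> t}
    = (\<Sum>j | j \<le> n \<and> rate j \<le> t * rate n. measure \<nu> ((T ^^ (n - j)) -` surviving (n - (n - j)) \<inter> space M))"
proof -
  interpret prob_space \<nu> using \<nu> by (simp add: ac_prob_measures_def)
  have s: "sets \<nu> = sets M" using \<nu> by (simp add: ac_prob_measures_def)
  let ?J = "{j. j \<le> n \<and> rate j \<le> t * rate n}"
  have J: "?J \<subseteq> {..n}" by auto
  have level: "spent_time_kac M T A n x \<le> t \<longleftrightarrow> visit_age n x \<in> ?J" for x
    using rate_pos[of n] by (simp add: spent_time_kac_eq pos_divide_le_eq)
  have "visit_age n x = n" if "x \<notin> hit_set M T A n" for x
    using that by (simp add: last_visit_def)
  moreover have "n \<notin> ?J" using t rate_pos[of n] by simp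
  ultimately have "{x \<in> space M. spent_time_kac M T A n x \<le> t} = {x \<in> hit_set M T A n. visit_age n x \<in> ?J}"
    unfolding level by (metis (no_types, lifting) hit_set_iff)
  also have "\<dots> = (\<Union>j\<in>?J. (T ^^ (n - j)) -` surviving j \<inter> space M)"
    by (rule last_visit_vimage(1)[OF J])
  also have "measure \<nu> \<dots> = (\<Sum>j\<in>?J. measure \<nu> ((T ^^ (n - j)) -` surviving j \<inter> space M))"
    by (rule finite_measure_finite_Union) (use last_visit_vimage(2)[OF J] in \<open>auto simp: s\<close>)
  also have "\<dots> = (\<Sum>j\<in>?J. measure \<nu> ((T ^^ (n - j)) -` surviving (n - (n - j)) \<inter> space M))"
    by (intro sum.cong) auto
  finally show ?thesis .
qed

text \<open>Passing from \<open>x\<close> to \<open>T x\<close> moves the time window one step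
  ahead, and by assumption no visit enters at its end. If the last visit is at time
  \<open>k > 0\<close>, it moves to \<open>k - 1\<close> and the age grows by one. If
  \<open>k = 0\<close>, the only visit drops out, and the default value 0 leaves the age at
  \<open>n\<close>.\<close>

lemma visit_age_shift:
  assumes x: "x \<in> hit_set M T A n" and out: "(T ^^ Suc n) x \<notin> A"
  shows "visit_age n (T x) = visit_age n x \<or> visit_age n (T x) = Suc (visit_age n x)"
proof -
  define k where "k = last_visit M T A n x"
  have k: "k \<le> n" and surv: "(T ^^ k) x \<in> surviving (n - k)"
    using last_visit_surviving[OF x] by (auto simp: k_def)
  have sp: "x \<in> space M" "T x \<in> space M" using x measurable_space[OF T_measurable] by (auto simp: hit_set_iff)
  have surv': "(T ^^ k) x \<in> surviving (Suc (n - k))"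
  proof -
    have "Suc n = Suc (n - k) + k" using k by simp
    then have "(T ^^ Suc (n - k)) ((T ^^ k) x) \<notin> A" using out by (metis comp_apply funpow_add)
    then show ?thesis using surv unfolding surviving_iff le_Suc_eq by metis
  qed
  show ?thesis
  proof (cases k)
    case 0
    have "T x \<notin> hit_set M T A n"
    proof
      assume "T x \<in> hit_set M T A n"
      then obtain j where "j \<le> n" "(T ^^ Suc j) x \<in> A" by (auto simp: hit_set_iff funpow_swap1)
      moreover have "1 \<le> Suc j" "Suc j \<le> Suc n" using \<open>j \<le> n\<close> by auto
      ultimately show False using surv' 0 unfolding surviving_iff by auto
    qed
    then have "last_visit M T A n (T x) = 0" by (simp add: last_visit_def)
    then show ?thesis using 0 by (simp add: k_def)
  next
    case (Suc i)
    have "(T ^^ i) (T x) \<in> surviving (n - i)"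
      using surv' Suc k by (simp add: funpow_swap1 Suc_diff_Suc)
    then have "last_visit M T A n (T x) = i"
      using Suc k sp by (intro last_visit_eqI) auto
    then show ?thesis using Suc k by (simp add: k_def[symmetric] Suc_diff_Suc)
  qed
qed

text \<open>One additional step of age adds one summand to the numerator, of size at most the
  measure of \<open>A\<close>.\<close>

lemma spent_time_kac_shift:
  assumes "x \<in> hit_set M T A n" "(T ^^ Suc n) x \<notin> A"
  shows "\<bar>spent_time_kac M T A n (T x) - spent_time_kac M T A n x\<bar> \<le> measure M A / rate n"
proof -
  have "\<bar>rate (visit_age n (T x)) - rate (visit_age n x)\<bar> \<le> measure M A"
    using visit_age_shift[OF assms]
  proof
    assume *: "visit_age n (T x) = Suc (visit_age n x)"
    have "measure M (surviving (Suc (visit_age n x))) \<le> measure M A"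
      using antimonoD[OF surviving_measure_props(2), of 0] by (simp add: surviving_0)
    then show ?thesis unfolding * by (simp add: rate_eq_sum)
  qed simp
  then show ?thesis
    using rate_pos[of n] unfolding spent_time_kac_eq diff_divide_distrib[symmetric]
    by (simp add: divide_right_mono)
qed

text \<open>Outside the event \<open>H n\<close> of no visit up to \<open>n\<close> and the event
  \<open>V n\<close> of a visit at time \<open>Suc n\<close>, the step function changes by at most
  its Lipschitz constant times the bound of \<open>spent_time_kac_shift\<close>. Both events have
  vanishing probability, and that bound vanishes because the wandering rate diverges.\<close>

lemma cts_step_asymptotically_invariant:
  assumes \<nu>: "\<nu> \<in> ac_prob_measures M" and ab: "a < b"
    and van: "(\<lambda>n. measure \<nu> ((T ^^ n) -` A \<inter> space M)) \<longlonglongrightarrow> 0"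
  shows "(\<lambda>n. (\<integral>x. cts_step a b (spent_time_kac M T A n (T x)) \<partial>\<nu>)
    - (\<integral>x. cts_step a b (spent_time_kac M T A n x) \<partial>\<nu>)) \<longlonglongrightarrow> 0"
proof -
  interpret prob_space \<nu> using \<nu> by (simp add: ac_prob_measures_def)
  have s: "sets \<nu> = sets M" using \<nu> by (simp add: ac_prob_measures_def)
  note sp = sets_eq_imp_space_eq[OF s]
  note [measurable_cong] = s
  define h where "h n x = cts_step a b (spent_time_kac M T A n x)" for n x
  have h01: "0 \<le> h n x" "h n x \<le> 1" for n x using ab by (auto simp: h_def cts_step_def)
  have h[measurable]: "h n \<in> borel_measurable M" for n
    unfolding h_def[abs_def] cts_step_def by measurable
  define K where "K n = measure M A / rate n / (b - a)" for n
  have K0: "0 \<le> K n" for n using rate_pos[of n] ab by (simp add: K_def)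
  define H where "H n = space M - hit_set M T A n" for n
  define V where "V n = (T ^^ Suc n) -` A \<inter> space M" for n
  have [measurable]: "H n \<in> sets M" "V n \<in> sets M" for n unfolding H_def V_def by measurable
  have bound: "\<bar>h n (T x) - h n x\<bar> \<le> indicator (H n) x + indicator (V n) x + K n" if "x \<in> space M" for n x
  proof (cases "x \<in> H n \<or> x \<in> V n")
    case True
    have "\<bar>h n (T x) - h n x\<bar> \<le> 1" using h01[of n x] h01[of n "T x"] by linarith
    moreover have "1 \<le> indicator (H n) x + (indicator (V n) x :: real)" using True by (auto simp: indicator_def)
    ultimately show ?thesis using K0[of n] by linarith
  next
    case False
    then have "\<bar>spent_time_kac M T A n (T x) - spent_time_kac M T A n x\<bar> \<le> measure M A / rate n"
      using that by (intro spent_time_kac_shift) (auto simp: H_def V_def)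
    then have "\<bar>spent_time_kac M T A n (T x) - spent_time_kac M T A n x\<bar> / (b - a) \<le> K n"
      unfolding K_def using ab by (intro divide_right_mono) auto
    then have "\<bar>h n (T x) - h n x\<bar> \<le> K n"
      using cts_step_Lipschitz[OF ab] unfolding h_def by (rule order_trans[rotated])
    moreover have "0 \<le> indicator (H n) x + (indicator (V n) x :: real)" by simp
    ultimately show ?thesis by linarith
  qed
  have inth: "integrable \<nu> (h n)" for n
    using h01 by (intro integrable_const_bound[where B=1]) auto
  have inthT: "integrable \<nu> (\<lambda>x. h n (T x))" for n
    using h01 by (intro integrable_const_bound[where B=1]) auto
  have le: "norm ((\<integral>x. h n (T x) \<partial>\<nu>) - (\<integral>x. h n x \<partial>\<nu>)) \<le> prob (H n) + prob (V n) + K n" for n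
  proof -
    have "\<bar>(\<integral>x. h n (T x) \<partial>\<nu>) - (\<integral>x. h n x \<partial>\<nu>)\<bar> = \<bar>\<integral>x. h n (T x) - h n x \<partial>\<nu>\<bar>"
      using inth inthT by simp
    also have "\<dots> \<le> (\<integral>x. \<bar>h n (T x) - h n x\<bar> \<partial>\<nu>)" by (rule integral_abs_bound)
    also have "\<dots> \<le> (\<integral>x. indicator (H n) x + indicator (V n) x + K n \<partial>\<nu>)"
      using bound inth inthT by (intro integral_mono) (auto simp: sp emeasure_eq_measure)
    also have "\<dots> = prob (H n) + prob (V n) + K n"
      by (simp add: emeasure_eq_measure prob_space)
    finally show ?thesis by simp
  qed
  have "(\<lambda>n. prob (H n) + prob (V n) + K n) \<longlonglongrightarrow> 0 + 0 + 0"
  proof (intro tendsto_add)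
    have "prob (H n) = 1 - prob (hit_set M T A n)" for n
      unfolding H_def sp[symmetric] by (intro prob_compl) simp
    then show "(\<lambda>n. prob (H n)) \<longlonglongrightarrow> 0"
      using tendsto_diff[OF tendsto_const[of 1] ac_prob_hit_set[OF \<nu>]] by simp
    show "(\<lambda>n. prob (V n)) \<longlonglongrightarrow> 0"
      unfolding V_def using LIMSEQ_Suc[OF van] by simp
    have "(\<lambda>n. measure M A / rate n / (b - a)) \<longlonglongrightarrow> 0 / (b - a)"
      by (intro tendsto_divide tendsto_const tendsto_divide_0[OF tendsto_const]
          filterlim_at_top_imp_at_infinity rate_at_top) (use ab in auto)
    then show "K \<longlonglongrightarrow> 0" by (simp add: K_def[abs_def])
  qed
  then have "(\<lambda>n. (\<integral>x. h n (T x) \<partial>\<nu>) - (\<integral>x. h n x \<partial>\<nu>)) \<longlonglongrightarrow> 0"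
    by (intro Lim_null_comparison[OF always_eventually[OF allI[OF le]]]) simp
  then show ?thesis by (simp add: h_def)
qed

end

section \<open>The uniform limit law, first under the density of uniform return\<close>

lemma measure_uniform_unit_interval_atMost:
  "measure (uniform_measure lborel {0..1}) {..t :: real} = max 0 (min 1 t)"
proof -
  have "{0..1} \<inter> {..t} = {0..min 1 t}" by auto
  then show ?thesis by (subst measure_uniform_measure) (auto simp: max_def)
qed

context finite_measure_section
begin

text \<open>With \<open>a n = 1 / b n\<close>, the uniform estimate on the transferred density is
  integrated over \<open>B\<close>, and duality turns the integral into the probability of being in
  \<open>B\<close> at time \<open>k\<close>. The threshold \<open>K\<close> serves all subsets
  \<open>B\<close> of \<open>A\<close> at once, as needed for sets that vary with
  \<open>n\<close>.\<close>

lemma uniformly_returning_asymptotics: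
  assumes ret: "uniformly_returning_for M T A f"
  obtains a :: "nat \<Rightarrow> real" where "\<And>n. 0 < a n" "antimono a" "a \<longlonglongrightarrow> 0"
    "\<And>e. 0 < e \<Longrightarrow> \<exists>K. \<forall>k\<ge>K. \<forall>B\<in>sets M. B \<subseteq> A \<longrightarrow>
      (1 - e) * (a k * measure M B) \<le> measure (density M (\<lambda>x. ennreal (f x))) ((T ^^ k) -` B \<inter> space M) \<and>
      measure (density M (\<lambda>x. ennreal (f x))) ((T ^^ k) -` B \<inter> space M) \<le> (1 + e) * (a k * measure M B)"
proof -
  obtain b N where f: "f \<in> ac_prob_densities M" and b: "\<And>n. 0 < b n" "incseq b" "filterlim b at_top sequentially"
    and N: "N \<in> null_sets M"
    and unif: "uniform_limit (A - N) (\<lambda>n x. b n * (transfer_op M T ^^ n) f x) (\<lambda>_. 1) sequentially"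
    using ret unfolding uniformly_returning_for_def by blast
  define a where "a n = 1 / b n" for n
  note transfer = transfer_op_funpow[OF integrable_ac_prob_density[OF f]]
  show ?thesis
  proof (rule that)
    show "0 < a n" for n using b(1) by (simp add: a_def)
    show "antimono a" using b(1,2) by (auto simp: a_def antimono_def incseq_def intro!: divide_left_mono)
    show "a \<longlonglongrightarrow> 0" unfolding a_def
      by (intro tendsto_divide_0[OF tendsto_const] filterlim_at_top_imp_at_infinity b(3))
    fix e :: real assume "0 < e"
    then obtain K where K: "\<And>k x. K \<le> k \<Longrightarrow> x \<in> A - N \<Longrightarrow> \<bar>b k * (transfer_op M T ^^ k) f x - 1\<bar> < e"
      using uniform_limitD[OF unif] unfolding eventually_sequentially dist_real_def by meson
    show "\<exists>K. \<forall>k\<ge>K. \<forall>B\<in>sets M. B \<subseteq> A \<longrightarrow>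
      (1 - e) * (a k * measure M B) \<le> measure (density M (\<lambda>x. ennreal (f x))) ((T ^^ k) -` B \<inter> space M) \<and>
      measure (density M (\<lambda>x. ennreal (f x))) ((T ^^ k) -` B \<inter> space M) \<le> (1 + e) * (a k * measure M B)"
    proof (intro exI allI ballI impI)
      fix k B assume k: "K \<le> k" and B[measurable]: "B \<in> sets M" and BA: "B \<subseteq> A"
      let ?g = "(transfer_op M T ^^ k) f"
      have "emeasure M B \<le> emeasure M A" using BA by (intro emeasure_mono) auto
      then have Bfin: "emeasure M B < \<infinity>" using A_finite by (simp add: order_le_less_trans)
      have "measure (density M (\<lambda>x. ennreal (f x))) ((T ^^ k) -` B \<inter> space M)
          = set_lebesgue_integral M ((T ^^ k) -` B \<inter> space M) f"
        by (rule measure_ac_prob_density[OF f]) measurable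
      also have "\<dots> = (\<integral>x. indicator B x * ?g x \<partial>M)"
        using transfer[of k] B by (simp add: set_lebesgue_integral_def)
      finally have eq: "measure (density M (\<lambda>x. ennreal (f x))) ((T ^^ k) -` B \<inter> space M)
          = (\<integral>x. indicator B x * ?g x \<partial>M)" .
      have int: "integrable M (\<lambda>x. indicator B x * ?g x)"
        using integrable_mult_indicator[OF B conjunct1[OF transfer[of k]]] by simp
      have indB: "integrable M (indicator B :: 'a \<Rightarrow> real)" using B Bfin by simp
      have const: "(\<integral>x. indicator B x * (c * a k) \<partial>M) = c * (a k * measure M B)" for c
        using sets.sets_into_space[OF B] by (simp add: Int_absorb2)
      have bounds: "AE x in M. indicator B x * ((1 - e) * a k) \<le> indicator B x * ?g x \<and>
          indicator B x * ?g x \<le> indicator B x * ((1 + e) * a k)"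
        using AE_not_in[OF N]
      proof eventually_elim
        case (elim x)
        show ?case
        proof (cases "x \<in> B")
          case True
          then have "\<bar>b k * ?g x - 1\<bar> < e" using elim BA k by (intro K) auto
          then have "1 - e \<le> b k * ?g x" "b k * ?g x \<le> 1 + e" by linarith+
          then show ?thesis using True b(1)[of k]
            by (simp add: a_def pos_divide_le_eq pos_le_divide_eq mult.commute)
        qed simp
      qed
      have "(\<integral>x. indicator B x * ((1 - e) * a k) \<partial>M) \<le> (\<integral>x. indicator B x * ?g x \<partial>M)"
        using bounds indB int by (intro integral_mono_AE) auto
      moreover have "(\<integral>x. indicator B x * ?g x \<partial>M) \<le> (\<integral>x. indicator B x * ((1 + e) * a k) \<partial>M)"
        using bounds indB int by (intro integral_mono_AE) auto
      ultimately show
        "(1 - e) * (a k * measure M B) \<le> measure (density M (\<lambda>x. ennreal (f x))) ((T ^^ k) -` B \<inter> space M) \<and>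
        measure (density M (\<lambda>x. ennreal (f x))) ((T ^^ k) -` B \<inter> space M) \<le> (1 + e) * (a k * measure M B)"
        unfolding eq const by blast
    qed
  qed
qed

lemma rate_double_ratio:
  assumes "slowly_varying_seq rate"
  shows "(\<lambda>n. rate (2 * n) / rate n) \<longlonglongrightarrow> 1"
proof -
  obtain R where R: "slowly_varying R" "\<And>n. 1 \<le> n \<Longrightarrow> rate n = R (real n)"
    using assms unfolding slowly_varying_seq_def by blast
  have "((\<lambda>t. R (2 * t) / R t) \<longlongrightarrow> 1) at_top"
    using R(1) by (simp add: slowly_varying_def)
  from filterlim_compose[OF this filterlim_real_sequentially]
  have "(\<lambda>n. R (2 * real n) / R (real n)) \<longlonglongrightarrow> 1" .
  moreover have "\<forall>\<^sub>F n in sequentially. R (2 * real n) / R (real n) = rate (2 * n) / rate n"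
    using eventually_ge_at_top[of 1] by eventually_elim (use R(2) in simp)
  ultimately show ?thesis by (rule Lim_transform_eventually)
qed

text \<open>The process takes values in the half-open interval from 0 (excluded) to 1, which settles
  \<open>t \<le> 0\<close> and \<open>t \<ge> 1\<close>. In between, \<open>renewal_limit\<close>
  applies to the distribution of the last visit time, whose total mass is the probability of the hit
  set.\<close>

lemma spent_time_kac_cdf_limit:
  assumes \<nu>: "\<nu> \<in> ac_prob_measures M" and sv: "slowly_varying_seq rate"
    and a: "\<And>n. 0 < a n" "antimono a"
    and asymp: "\<And>e. 0 < e \<Longrightarrow> \<exists>K. \<forall>k\<ge>K. \<forall>B\<in>sets M. B \<subseteq> A \<longrightarrow>
      (1 - e) * (a k * measure M B) \<le> measure \<nu> ((T ^^ k) -` B \<inter> space M) \<and>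
      measure \<nu> ((T ^^ k) -` B \<inter> space M) \<le> (1 + e) * (a k * measure M B)"
  shows "(\<lambda>n. measure \<nu> {x \<in> space M. spent_time_kac M T A n x \<le> t}) \<longlonglongrightarrow> max 0 (min 1 t)"
proof -
  interpret prob_space \<nu> using \<nu> by (simp add: ac_prob_measures_def)
  have s: "sets \<nu> = sets M" using \<nu> by (simp add: ac_prob_measures_def)
  consider "t \<le> 0" | "1 \<le> t" | "0 < t" "t < 1" by linarith
  then show ?thesis
  proof cases
    case 1
    have "\<not> spent_time_kac M T A n x \<le> t" for n x using 1 spent_time_kac_bounds(1)[of n x] by linarith
    then show ?thesis using 1 by simp
  next
    case 2
    have "spent_time_kac M T A n x \<le> t" for n x using 2 spent_time_kac_bounds(2)[of n x] by linarith
    then show ?thesis using 2 prob_space sets_eq_imp_space_eq[OF s] by simp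
  next
    case 3
    define p where "p n k = prob ((T ^^ k) -` surviving (n - k) \<inter> space M)" for n k
    have total: "(\<Sum>k\<le>n. p n k) = prob (hit_set M T A n)" for n
    proof -
      have "prob (hit_set M T A n) = (\<Sum>j\<le>n. prob ((T ^^ (n - j)) -` surviving j \<inter> space M))"
        unfolding hit_set_decomp using last_visit_vimage(2)[of "{..n}" n]
        by (intro finite_measure_finite_Union) (auto simp: s)
      also have "\<dots> = (\<Sum>k\<le>n. p n k)"
        unfolding p_def by (rule sum.reindex_bij_witness[of _ "\<lambda>k. n - k" "\<lambda>k. n - k"]) auto
      finally show ?thesis by simp
    qed
    have "(\<lambda>n. \<Sum>j | j \<le> n \<and> rate j \<le> t * rate n. p n (n - j)) \<longlonglongrightarrow> t"
    proof (rule renewal_limit[OF a surviving_measure_props rate_eq_sum rate_at_top rate_double_ratio[OF sv]])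
      show "0 \<le> p n k" for n k by (simp add: p_def)
      show "(\<Sum>k\<le>n. p n k) \<le> 1" for n by (simp add: total)
      show "(\<lambda>n. \<Sum>k\<le>n. p n k) \<longlonglongrightarrow> 1" unfolding total by (rule ac_prob_hit_set[OF \<nu>])
      show "(\<lambda>n. p n k) \<longlonglongrightarrow> 0" for k unfolding p_def by (rule ac_prob_fixed_visit[OF \<nu>])
      show "\<exists>K. \<forall>n k. K \<le> k \<longrightarrow> k \<le> n \<longrightarrow>
          (1 - e) * (a k * measure M (surviving (n - k))) \<le> p n k \<and>
          p n k \<le> (1 + e) * (a k * measure M (surviving (n - k)))" if "0 < e" for e
      proof -
        have "surviving j \<subseteq> A" for j by (auto simp: surviving_iff)
        then show ?thesis using asymp[OF that] surviving_measurable unfolding p_def by meson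
      qed
    qed (use 3 in auto)
    then show ?thesis
      using 3 by (simp add: spent_time_kac_sublevel[OF \<nu>] p_def)
  qed
qed

text \<open>The distribution functions give the limit under the measure \<open>\<nu>0\<close> of
  uniform return. Weak convergence is determined by the functions \<open>cts_step u v\<close>; their
  integrals converge to the same limit under every absolutely continuous measure by asymptotic
  invariance.\<close>

lemma spent_time_kac_strong_limit:
  assumes ret: "uniformly_returning M T A" and sv: "slowly_varying_seq rate"
    and \<nu>: "\<nu> \<in> ac_prob_measures M"
  shows "weak_conv_m (\<lambda>n. distr \<nu> borel (spent_time_kac M T A n)) (uniform_measure lborel {0..1})"
proof -
  let ?U = "uniform_measure lborel {0..1::real}"
  have U: "real_distribution ?U"
    by (intro real_distribution.intro prob_space_uniform_measure real_distribution_axioms.intro) auto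
  have rd: "real_distribution (distr \<kappa> borel (spent_time_kac M T A n))"
    and \<kappa>m: "spent_time_kac M T A n \<in> borel_measurable \<kappa>"
    if \<kappa>: "\<kappa> \<in> ac_prob_measures M" for \<kappa> n
  proof -
    interpret prob_space \<kappa> using \<kappa> by (simp add: ac_prob_measures_def)
    have s: "sets \<kappa> = sets M" using \<kappa> by (simp add: ac_prob_measures_def)
    show *: "spent_time_kac M T A n \<in> borel_measurable \<kappa>" by (simp add: measurable_cong_sets[OF s refl])
    show "real_distribution (distr \<kappa> borel (spent_time_kac M T A n))"
      by (rule real_distribution_distr[OF *])
  qed
  obtain f where f: "f \<in> ac_prob_densities M" "uniformly_returning_for M T A f"
    using ret by (auto simp: uniformly_returning_def)
  define \<nu>0 where "\<nu>0 = density M (\<lambda>x. ennreal (f x))"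
  have \<nu>0: "\<nu>0 \<in> ac_prob_measures M" using f(1) by (simp add: ac_prob_densities_def \<nu>0_def)
  have sp0: "space \<nu>0 = space M" by (simp add: \<nu>0_def)
  obtain a where a: "\<And>n. 0 < a n" "antimono a" and a0: "a \<longlonglongrightarrow> 0"
    and asymp: "\<And>e. 0 < e \<Longrightarrow> \<exists>K. \<forall>k\<ge>K. \<forall>B\<in>sets M. B \<subseteq> A \<longrightarrow>
      (1 - e) * (a k * measure M B) \<le> measure \<nu>0 ((T ^^ k) -` B \<inter> space M) \<and>
      measure \<nu>0 ((T ^^ k) -` B \<inter> space M) \<le> (1 + e) * (a k * measure M B)"
    by (rule uniformly_returning_asymptotics[OF f(2), folded \<nu>0_def]) (rule that)
  have cdf: "cdf (distr \<nu>0 borel (spent_time_kac M T A n)) t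
      = measure \<nu>0 {x \<in> space M. spent_time_kac M T A n x \<le> t}" for n t
    unfolding cdf_def2 by (subst measure_distr[OF \<kappa>m[OF \<nu>0]])
      (auto simp: sp0 intro!: arg_cong[where f="measure \<nu>0"])
  have conv0: "weak_conv_m (\<lambda>n. distr \<nu>0 borel (spent_time_kac M T A n)) ?U"
    unfolding weak_conv_m_def weak_conv_def cdf
    using spent_time_kac_cdf_limit[OF \<nu>0 sv a asymp]
    by (simp add: cdf_def2 measure_uniform_unit_interval_atMost)
  \<comment> \<open>The asymptotic upper bound with \<open>e = 1\<close> and \<open>B = A\<close>,
    together with \<open>a\<close> tending to 0.\<close>
  have van0: "(\<lambda>n. measure \<nu>0 ((T ^^ n) -` A \<inter> space M)) \<longlonglongrightarrow> 0"
  proof -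
    obtain K where K: "\<And>k. K \<le> k \<Longrightarrow> measure \<nu>0 ((T ^^ k) -` A \<inter> space M) \<le> (1 + 1) * (a k * measure M A)"
      using asymp[OF zero_less_one] A_sets by blast
    have "(\<lambda>k. (1 + 1) * (a k * measure M A)) \<longlonglongrightarrow> (1 + 1) * (0 * measure M A)"
      by (intro tendsto_intros a0)
    then have lim: "(\<lambda>k. (1 + 1) * (a k * measure M A)) \<longlonglongrightarrow> 0" by simp
    show ?thesis
      by (rule tendsto_sandwich[OF _ _ tendsto_const lim])
        (use K in \<open>auto simp: eventually_sequentially\<close>)
  qed
  have "(\<lambda>n. \<integral>x. cts_step u v x \<partial>distr \<nu> borel (spent_time_kac M T A n)) \<longlonglongrightarrow> (\<integral>x. cts_step u v x \<partial>?U)"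
    if uv: "u < v" for u v
  proof -
    have [measurable]: "cts_step u v \<in> borel_measurable borel" unfolding cts_step_def[abs_def] by measurable
    have as_integral: "(\<integral>x. cts_step u v x \<partial>distr \<kappa> borel (spent_time_kac M T A n))
        = (\<integral>x. cts_step u v (spent_time_kac M T A n x) \<partial>\<kappa>)" if "\<kappa> \<in> ac_prob_measures M" for \<kappa> n
      by (rule integral_distr[OF \<kappa>m[OF that]]) measurable
    have cont: "isCont (cts_step u v) x" for x
      using uniformly_continuous_imp_continuous[OF cts_step_uniformly_continuous[OF uv]]
      by (simp add: continuous_on_eq_continuous_at)
    have "(\<lambda>n. \<integral>x. cts_step u v x \<partial>distr \<nu>0 borel (spent_time_kac M T A n)) \<longlonglongrightarrow> (\<integral>x. cts_step u v x \<partial>?U)"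
      by (rule weak_conv_imp_integral_bdd_continuous_conv[OF rd[OF \<nu>0] U conv0 cont, where B=1])
        (use uv in \<open>auto simp: cts_step_def\<close>)
    then have "(\<lambda>n. \<integral>x. cts_step u v (spent_time_kac M T A n x) \<partial>\<nu>0) \<longlonglongrightarrow> (\<integral>x. cts_step u v x \<partial>?U)"
      by (simp add: as_integral[OF \<nu>0])
    then have "(\<lambda>n. \<integral>x. cts_step u v (spent_time_kac M T A n x) \<partial>\<nu>) \<longlonglongrightarrow> (\<integral>x. cts_step u v x \<partial>?U)"
    proof (intro strong_limit_if_asymptotically_invariant[OF _ _ _ \<nu>0 _ _ \<nu>])
      show "(\<lambda>x. cts_step u v (spent_time_kac M T A n x)) \<in> borel_measurable M" for n by measurable
      show "0 \<le> cts_step u v (spent_time_kac M T A n x)" "cts_step u v (spent_time_kac M T A n x) \<le> 1" for n x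
        using uv by (auto simp: cts_step_def)
      show "(\<lambda>n. (\<integral>x. cts_step u v (spent_time_kac M T A n (T x)) \<partial>\<kappa>)
          - (\<integral>x. cts_step u v (spent_time_kac M T A n x) \<partial>\<kappa>)) \<longlonglongrightarrow> 0"
        if \<kappa>: "\<kappa> \<in> ac_prob_measures M" for \<kappa>
        by (rule cts_step_asymptotically_invariant[OF \<kappa> uv strong_vanishing[OF A_sets \<nu>0 van0 \<kappa>]])
    qed
    then show ?thesis by (simp add: as_integral[OF \<nu>])
  qed
  then show ?thesis
    by (intro integral_cts_step_conv_imp_weak_conv rd[OF \<nu>] U)
qed

end

theorem theorem1p6:
  fixes M :: "'a measure" and T :: "'a \<Rightarrow> 'a" and A :: "'a set"
    and P :: "'b measure" and U :: "'b \<Rightarrow> real"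
  assumes "sigma_finite_measure M"
    and "emeasure M (space M) = \<infinity>"
    and "measure_preserving M T"
    and "conservative M T"
    and "ergodic M T"
    and "A \<in> sets M" and "0 < emeasure M A" and "emeasure M A < \<infinity>"
    and "uniformly_returning M T A"
    and "slowly_varying_seq (wandering_rate M T A)"
    and "prob_space P" and "U \<in> borel_measurable P"
    and "distr P borel U = uniform_measure lborel {0..1}"
  shows "strong_distributional_conv M (spent_time_kac M T A) P U"
proof -
  interpret finite_measure_section M T A
    by (intro finite_measure_section.intro conservative_ergodic_system.intro assms
        conservative_ergodic_system_axioms.intro finite_measure_section_axioms.intro)
  show ?thesis
    unfolding strong_distributional_conv_def assms(13)
    using spent_time_kac_measurable spent_time_kac_strong_limit[OF assms(9,10)] by blast
qed

end
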